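(* Let $\phi\in L^\infty(\mathbb{T})$ and $a\in\mathbb{D}$. Then the following are equivalent: (a) $T_\phi$ is $C_{\alpha,a}$-symmetric for some $\alpha\in\mathscr{M}$. (b) $T_\phi$ is $C_{\lambda,a}$-symmetric for some $\lambda\in\mathbb{T}$. (c) $T_{\phi\circ\varphi_a}$ is $C_\lambda$-symmetric for some $\lambda\in\mathbb{T}$. (d) $\phi=f\circ\varphi_a+\overline{C_\lambda(f)\circ\varphi_a}$ for some $\lambda\in\mathbb{T}$ and $f\in H^2$. (e) There is $\lambda\in\mathbb{T}$ such that $(\phi\circ\varphi_a)(\lambda z)=(\phi\circ\varphi_a)(\bar z)$ for a.e. $z\in\mathbb{T}$.
   Context: $\mathbb{D}$ is the open unit disk in $\mathbb{C}$, $\mathbb{T}$ its boundary with normalized Haar measure $\sigma$, $L^2=L^2(\mathbb{T},\sigma)$. $H^2$ is the Hardy space of $\mathbb{D}$, identified via boundary functions with a closed subspace of $L^2$; $P:L^2\to H^2$ is the orthogonal projection. For $\phi\in L^\infty(\mathbb{T})$, the Toeplitz operator is $T_\phi f=P(\phi f)$ for $f\in H^2$. Equalities between symbols hold a.e. on $\mathbb{T}$. A conjugation on $H^2$ is a conjugate-linear map $C:H^2\to H^2$ with $C^2=I$ and $\langle Cx,Cy\rangle=\langle y,x\rangle$ for all $x,y$. A bounded operator $T$ is $C$-symmetric if $CTC=T^*$. For $\lambda\in\mathbb{T}$, $C_\lambda$ is the conjugation $C_\lambda h(z)=\overline{h(\lambda\bar z)}$, i.e. $C_\lambda\big(\sum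 c_nz^n\big)=\sum\overline{c_n}\,\overline{\lambda^n}z^n$. $\mathscr{M}$ is the set of all sequences $\alpha=(\alpha_0,\alpha_1,\dots)$ with every $\alpha_n\in\mathbb{T}$. For $a\in\mathbb{D}$, $\varphi_a(z)=\frac{a-z}{1-\bar az}$, $K_a(z)=\frac1{1-\bar az}$, $e_a=\sqrt{1-|a|^2}\,K_a$; the set $\{\varphi_a^me_a:m\ge0\}$ is an orthonormal basis of $H^2$. For $\alpha\in\mathscr{M}$, $C_{\alpha,a}$ is the conjugation on $H^2$ defined by $C_{\alpha,a}\big(\sum_{m\ge0}\mu_m\varphi_a^me_a\big)=\sum_{m\ge0}\overline{\mu_m}\,\alpha_m\varphi_a^me_a$, and for $\lambda\in\mathbb{T}$, $C_{\lambda,a}$ denotes $C_{\alpha,a}$ with $\alpha_m=\bar\lambda^m$. *)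

theory Defs
  imports "HOL-Complex_Analysis.Complex_Analysis" "HOL-Probability.Probability"
begin

text \<open>
  Elements of \<open>L\<^sup>2\<close>, \<open>L\<^sup>\<infinity>\<close> and \<open>H\<^sup>2\<close> are represented by functions on the unit circle and are never
  quotiented: equality of two elements is equality almost everywhere, and an operator is a map on
  representatives. Where a value is determined only up to a null set it is picked with \<open>SOME\<close>.
\<close>

definition circle :: "complex measure" where
  "circle = distr (uniform_measure lborel {0..<2 * pi}) (restrict_space borel (sphere 0 1)) cis"

definition L2 :: "(complex \<Rightarrow> complex) set" where
  "L2 = {f \<in> borel_measurable circle. integrable circle (\<lambda>z. (cmod (f z))\<^sup>2)}"

definition Linf :: "(complex \<Rightarrow> complex) set" where
  "Linf = {f \<in> borel_measurable circle. \<exists>B. AE z in circle. cmod (f z) \<le> B}"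

definition inner_L2 :: "(complex \<Rightarrow> complex) \<Rightarrow> (complex \<Rightarrow> complex) \<Rightarrow> complex" where
  "inner_L2 f g = (LINT z|circle. f z * cnj (g z))"

definition sums_L2 :: "(nat \<Rightarrow> complex \<Rightarrow> complex) \<Rightarrow> (complex \<Rightarrow> complex) \<Rightarrow> bool" where
  "sums_L2 u f \<longleftrightarrow> (\<forall>m. u m \<in> L2) \<and> f \<in> L2 \<and>
     (\<lambda>N. LINT z|circle. (cmod (f z - (\<Sum>m<N. u m z)))\<^sup>2) \<longlonglongrightarrow> 0"

definition hardy_disk :: "(complex \<Rightarrow> complex) set" where
  "hardy_disk = {F. F holomorphic_on ball 0 1 \<and>
     (\<exists>B. \<forall>r. 0 \<le> r \<and> r < 1 \<longrightarrow> (LINT z|circle. (cmod (F (of_real r * z)))\<^sup>2) \<le> B)}"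

text \<open>
  The boundary function is the limit in \<open>L\<^sup>2\<close> of the dilates \<open>z \<mapsto> F (r z)\<close> as \<open>r\<close> increases to 1;
  by Fatou's theorem it is a.e. equal to the radial limit.
\<close>

definition boundary_function :: "(complex \<Rightarrow> complex) \<Rightarrow> (complex \<Rightarrow> complex) \<Rightarrow> bool" where
  "boundary_function F f \<longleftrightarrow> f \<in> L2 \<and>
     ((\<lambda>r. LINT z|circle. (cmod (F (of_real r * z) - f z))\<^sup>2) \<longlongrightarrow> 0) (at_left 1)"

definition H2 :: "(complex \<Rightarrow> complex) set" where
  "H2 = {f. \<exists>F \<in> hardy_disk. boundary_function F f}"

definition proj_H2 :: "(complex \<Rightarrow> complex) \<Rightarrow> complex \<Rightarrow> complex" where
  "proj_H2 f = (SOME g. g \<in> H2 \<and> (\<forall>h\<in>H2. inner_L2 (\<lambda>z. f z - g z) h = 0))"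

definition toeplitz :: "(complex \<Rightarrow> complex) \<Rightarrow> (complex \<Rightarrow> complex) \<Rightarrow> complex \<Rightarrow> complex" where
  "toeplitz \<phi> f = proj_H2 (\<lambda>z. \<phi> z * f z)"

definition adjoint_H2 ::
    "((complex \<Rightarrow> complex) \<Rightarrow> complex \<Rightarrow> complex) \<Rightarrow> (complex \<Rightarrow> complex) \<Rightarrow> complex \<Rightarrow> complex" where
  "adjoint_H2 T g = (SOME h. h \<in> H2 \<and> (\<forall>f\<in>H2. inner_L2 (T f) g = inner_L2 f h))"

definition C_symmetric ::
    "((complex \<Rightarrow> complex) \<Rightarrow> complex \<Rightarrow> complex) \<Rightarrow>
     ((complex \<Rightarrow> complex) \<Rightarrow> complex \<Rightarrow> complex) \<Rightarrow> bool" where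
  "C_symmetric C T \<longleftrightarrow> (\<forall>f\<in>H2. AE z in circle. C (T (C f)) z = adjoint_H2 T f z)"

definition conj_rot :: "complex \<Rightarrow> (complex \<Rightarrow> complex) \<Rightarrow> complex \<Rightarrow> complex" where
  "conj_rot lam h z = cnj (h (lam * cnj z))"

definition unimodular_seqs :: "(nat \<Rightarrow> complex) set" where
  "unimodular_seqs = {\<alpha>. \<forall>n. \<alpha> n \<in> sphere 0 1}"

definition disk_aut :: "complex \<Rightarrow> complex \<Rightarrow> complex" where
  "disk_aut a z = (a - z) / (1 - cnj a * z)"

definition szego_kernel :: "complex \<Rightarrow> complex \<Rightarrow> complex" where
  "szego_kernel a z = 1 / (1 - cnj a * z)"

definition normalized_kernel :: "complex \<Rightarrow> complex \<Rightarrow> complex" where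
  "normalized_kernel a z = of_real (sqrt (1 - (cmod a)\<^sup>2)) * szego_kernel a z"

definition aut_basis :: "complex \<Rightarrow> nat \<Rightarrow> complex \<Rightarrow> complex" where
  "aut_basis a m z = disk_aut a z ^ m * normalized_kernel a z"

definition conj_seq ::
    "(nat \<Rightarrow> complex) \<Rightarrow> complex \<Rightarrow> (complex \<Rightarrow> complex) \<Rightarrow> complex \<Rightarrow> complex" where
  "conj_seq \<alpha> a f = (SOME g. g \<in> H2 \<and>
     (\<exists>\<mu>. sums_L2 (\<lambda>m z. \<mu> m * aut_basis a m z) f \<and>
          sums_L2 (\<lambda>m z. cnj (\<mu> m) * \<alpha> m * aut_basis a m z) g))"

definition conj_rot_at :: "complex \<Rightarrow> complex \<Rightarrow> (complex \<Rightarrow> complex) \<Rightarrow> complex \<Rightarrow> complex" where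
  "conj_rot_at lam a = conj_seq (\<lambda>m. cnj lam ^ m) a"

end

theory Submission
  imports Defs
begin

text \<open>
  Write \<open>\<phi>\<^sub>a\<close> for the disk automorphism and \<open>c\<close> for the Fourier coefficients of \<open>\<psi> = \<phi> \<circ> \<phi>\<^sub>a\<close>. Each of
  the five conditions is shown to be equivalent to the existence of a unimodular \<open>lam\<close> with
  \<open>c (- k) = lam ^ k * c k\<close> for every integer \<open>k\<close>.

  For the operator conditions, let \<open>C\<close> be a conjugation that multiplies the members of an orthonormal
  basis \<open>b\<close> of \<open>H\<^sup>2\<close> by unimodular numbers \<open>\<alpha> m\<close>. A Toeplitz operator with matrix \<open>t n m\<close> in this basis is
  \<open>C\<close>-symmetric exactly if \<open>\<alpha> m * cnj (\<alpha> n) * t n m = t m n\<close> for all \<open>m\<close> and \<open>n\<close>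
  (\<open>C_symmetric_toeplitz_iff\<close>). For the basis \<open>\<phi>\<^sub>a ^ m * e\<^sub>a\<close> and the symbol \<open>\<phi>\<close>, as for the monomials and the
  symbol \<open>\<psi>\<close>, one has \<open>t n m = c (n - m)\<close>: the map \<open>f \<mapsto> (f \<circ> \<phi>\<^sub>a) * e\<^sub>a\<close> is a unitary involution that
  exchanges the two bases and intertwines multiplication by \<open>\<phi>\<close> and by \<open>\<psi>\<close>
  (\<open>inner_aut_basis_fourier_coeff\<close>). If \<open>\<alpha> m = cnj lam ^ m\<close>, the matrix condition is the condition on \<open>c\<close>.
  For arbitrary \<open>\<alpha>\<close> it only determines the phase of \<open>\<alpha>\<close> along the indices where \<open>c\<close> does not vanish; there
  shifting \<open>\<alpha>\<close> multiplies it by a constant, and these constants form a character of a subgroup of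
  the integers, which extends to \<open>k \<mapsto> lam ^ k\<close> (\<open>diagonal_unitary_to_character\<close>).

  The two conditions on the symbol are read off from Fourier coefficients: rotation by \<open>lam\<close> multiplies
  \<open>c k\<close> by \<open>lam ^ k\<close> and conjugating the variable replaces it by \<open>c (- k)\<close>, while for the decomposition
  \<open>\<psi> z = f z + f (lam * cnj z)\<close> the function \<open>f\<close> has to consist of the positive part of the Fourier
  series of \<open>\<psi>\<close> and half of its constant term.

  The analysis behind this has two sources. One is that a finite measure on the circle is determined by
  its moments (\<open>finite_measure_circle_eqI\<close>), which yields uniqueness of Fourier coefficients and also the
  change of variables under \<open>\<phi>\<^sub>a\<close>, with the Poisson kernel as density. The other is completeness of \<open>L\<^sup>2\<close>,
  which together with uniqueness identifies \<open>H\<^sup>2\<close> with the functions without negative Fourier coefficients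
  (\<open>H2_iff_fourier_coeff\<close>).
\<close>

section \<open>Integration over the unit circle\<close>

lemma cis_measurable_circle:
  "cis \<in> uniform_measure lborel {0..<2 * pi} \<rightarrow>\<^sub>M restrict_space borel (sphere 0 1)"
proof -
  have "cis \<in> borel_measurable borel"
    by (intro borel_measurable_continuous_onI continuous_intros)
  then show ?thesis
    by (intro measurable_restrict_space2) auto
qed

lemma sets_circle: "sets circle = sets (restrict_space borel (sphere 0 1))"
  by (simp add: circle_def)

lemma space_circle [simp]: "space circle = sphere 0 1"
  by (simp add: circle_def space_restrict_space)

lemma prob_space_circle: "prob_space circle"
proof -
  have "prob_space (uniform_measure lborel {0..<2 * pi})"
    by (rule prob_space_uniform_measure) auto
  then show ?thesis
    unfolding circle_def by (rule prob_space.prob_space_distr) (rule cis_measurable_circle)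
qed

interpretation circle: prob_space circle
  by (rule prob_space_circle)

lemma continuous_on_circle_measurable:
  fixes f :: "complex \<Rightarrow> 'b :: topological_space"
  assumes "continuous_on (sphere 0 1) f"
  shows "f \<in> borel_measurable circle"
  using borel_measurable_continuous_on_restrict[OF assms] measurable_cong_sets[OF sets_circle refl]
  by blast

lemma id_measurable_circle [measurable]: "(\<lambda>z. z) \<in> borel_measurable circle"
  by (intro continuous_on_circle_measurable continuous_intros)

lemma cnj_borel_measurable [measurable]: "cnj \<in> borel_measurable borel"
  by (intro borel_measurable_continuous_onI continuous_intros)

lemma measurable_to_circle:
  assumes "g \<in> borel_measurable circle" "\<And>z. cmod z = 1 \<Longrightarrow> cmod (g z) = 1"
  shows "g \<in> circle \<rightarrow>\<^sub>M circle"
proof -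
  have "g \<in> circle \<rightarrow>\<^sub>M restrict_space borel (sphere 0 1)"
    using assms by (intro measurable_restrict_space2) auto
  then show ?thesis
    using measurable_cong_sets[OF refl sets_circle] by blast
qed

lemma integrable_circle_bounded:
  fixes f :: "complex \<Rightarrow> 'b :: {banach, second_countable_topology}"
  assumes "f \<in> borel_measurable circle" "\<And>z. cmod z = 1 \<Longrightarrow> norm (f z) \<le> B"
  shows "integrable circle f"
  using assms by (intro circle.integrable_const_bound[where B = B]) auto

lemma continuous_on_sphere_bounded:
  fixes f :: "complex \<Rightarrow> 'b :: real_normed_vector"
  assumes "continuous_on (sphere 0 1) f"
  obtains B where "\<And>z. cmod z = 1 \<Longrightarrow> norm (f z) \<le> B"
proof -
  have "bounded (f ` sphere 0 1)"
    using assms compact_imp_bounded compact_continuous_image compact_sphere by blast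
  then obtain B where "\<forall>x\<in>f ` sphere 0 1. norm x \<le> B"
    unfolding bounded_iff by blast
  then show thesis by (intro that[of B]) auto
qed

lemma continuous_on_circle_integrable:
  fixes f :: "complex \<Rightarrow> 'b :: {banach, second_countable_topology}"
  assumes "continuous_on (sphere 0 1) f"
  shows "integrable circle f"
  using continuous_on_sphere_bounded[OF assms] continuous_on_circle_measurable[OF assms]
    integrable_circle_bounded by metis

text \<open>For continuous integrands the measure turns into an ordinary integral over \<open>[0, 2\<pi>]\<close>, the form
  in which contour integrals over a circle are given.\<close>
lemma integral_circle_continuous:
  fixes f :: "complex \<Rightarrow> complex"
  assumes "continuous_on (sphere 0 1) f"
  shows "(LINT z|circle. f z) = integral {0..2 * pi} (\<lambda>t. f (cis t)) / (2 * pi)"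
proof -
  have cont: "continuous_on A (\<lambda>t. f (cis t))" for A
    by (rule continuous_on_compose2[OF assms]) (auto intro!: continuous_intros)
  have f: "f \<in> borel_measurable (restrict_space borel (sphere 0 1))"
    by (rule borel_measurable_continuous_on_restrict[OF assms])
  have bm: "(\<lambda>t. f (cis t)) \<in> borel_measurable borel"
    by (intro borel_measurable_continuous_onI cont)
  have "(LINT z|circle. f z) = (LINT t|uniform_measure lborel {0..<2 * pi}. f (cis t))"
    unfolding circle_def by (rule integral_distr[OF cis_measurable_circle f])
  also have "\<dots> = (LINT t|lborel. (indicator {0..<2 * pi} t / measure lborel {0..<2 * pi}) *\<^sub>R f (cis t))"
  proof -
    have "uniform_measure lborel {0..<2 * pi} = 
        density lborel (\<lambda>t. ennreal (indicator {0..<2 * pi} t / measure lborel {0..<2 * pi}))"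
      unfolding uniform_measure_def
      by (intro density_cong) (auto simp: indicator_def divide_ennreal simp flip: ennreal_1)
    then show ?thesis
      using bm by (simp add: integral_density)
  qed
  also have "\<dots> = (LINT t|lborel. (1 / (2 * pi)) *\<^sub>R (indicator {0..2 * pi} t *\<^sub>R f (cis t)))"
    using AE_lborel_singleton[of "2 * pi"] bm
    by (intro integral_cong_AE) (auto elim!: eventually_mono simp: indicator_def)
  also have "\<dots> = (1 / (2 * pi)) *\<^sub>R (LINT t:{0..2 * pi}|lborel. f (cis t))"
    unfolding set_lebesgue_integral_def by (rule integral_scaleR_right)
  also have "(LINT t:{0..2 * pi}|lborel. f (cis t)) = integral {0..2 * pi} (\<lambda>t. f (cis t))"
    by (intro set_borel_integral_eq_integral borel_integrable_atLeastAtMost' cont)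
  finally show ?thesis
    by (simp add: scaleR_conv_of_real)
qed

text \<open>On the circle \<open>d\<sigma> = dz / (2\<pi>\<i>z)\<close>, so this is Cauchy's integral formula for the circle path.\<close>
lemma integral_circle_Cauchy:
  assumes "continuous_on (cball 0 1) G" "G holomorphic_on ball 0 1" "cmod a < 1"
  shows "(LINT z|circle. G z * z / (z - a)) = G a"
proof -
  have "((\<lambda>u. G u / (u - a)) has_contour_integral (2 * of_real pi * \<i> * G a)) (circlepath 0 1)"
    using assms by (intro Cauchy_integral_circlepath) auto
  then have "2 * of_real pi * \<i> * G a = contour_integral (circlepath 0 1) (\<lambda>u. G u / (u - a))"
    by (simp add: contour_integral_unique)
  also have "\<dots> = integral {0..2 * pi} (\<lambda>t. G (cis t) / (cis t - a) * \<i> * cis t)"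
    unfolding circlepath_def by (subst contour_integral_part_circlepath_eq) (auto simp: mult_ac)
  also have "\<dots> = integral {0..2 * pi} (\<lambda>t. \<i> * (G (cis t) * cis t / (cis t - a)))"
    by (simp add: mult_ac)
  also have "\<dots> = \<i> * integral {0..2 * pi} (\<lambda>t. G (cis t) * cis t / (cis t - a))"
    by (rule integral_mult_right)
  finally have *: "integral {0..2 * pi} (\<lambda>t. G (cis t) * cis t / (cis t - a)) = 2 * pi * G a"
    by (simp add: mult_ac)
  have "continuous_on (sphere 0 1) (\<lambda>z. G z * z / (z - a))"
    using assms(3) by (intro continuous_intros continuous_on_subset[OF assms(1)]) auto
  from integral_circle_continuous[OF this] * show ?thesis
    by simp
qed

corollary integral_circle_mean_value:
  assumes "continuous_on (cball 0 1) G" "G holomorphic_on ball 0 1"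
  shows "(LINT z|circle. G z) = G 0"
proof -
  have "(LINT z|circle. G z) = (LINT z|circle. G z * z / (z - 0))"
    by (rule Bochner_Integration.integral_cong) auto
  then show ?thesis
    using integral_circle_Cauchy[OF assms, of 0] by simp
qed

lemma cnj_eq_inverse_circle: "cmod z = 1 \<Longrightarrow> cnj z = inverse z"
  using divide_conv_cnj[of z 1] by (simp add: inverse_eq_divide)

text \<open>The trigonometric moments of \<open>\<sigma>\<close>. They determine \<open>\<sigma>\<close>, and this is how every invariance of
  \<open>\<sigma>\<close> below is obtained.\<close>
lemma integral_circle_powi:
  "(LINT z|circle. z powi k) = (if k = 0 then 1 else 0)"
proof -
  have nonneg: "(LINT z|circle. z ^ n) = (if n = 0 then 1 else 0)" for n
    by (subst integral_circle_mean_value) (auto intro!: continuous_intros holomorphic_intros)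
  show ?thesis
  proof (cases "k \<ge> 0")
    case True
    then show ?thesis using nonneg[of "nat k"] by (simp add: power_int_def)
  next
    case False
    have "(LINT z|circle. z powi k) = (LINT z|circle. cnj (z ^ nat (-k)))"
      using False by (intro Bochner_Integration.integral_cong)
        (auto simp: power_int_def cnj_eq_inverse_circle)
    also have "\<dots> = 0"
      using nonneg[of "nat (-k)"] False by (simp del: complex_cnj_power)
    finally show ?thesis using False by simp
  qed
qed

section \<open>Measures and functions on the circle are determined by their Fourier coefficients\<close>

text \<open>Because \<open>z * cnj z = 1\<close> on the circle, a real polynomial in the two coordinates is a
  trigonometric polynomial there; multiplying by a power of \<open>z\<close> clears the negative exponents. This
  turns the Stone-Weierstrass theorem for real polynomials into density of trigonometric polynomials.\<close>
lemma real_polynomial_on_circle: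
  fixes f :: "complex \<Rightarrow> real"
  assumes "real_polynomial_function f"
  shows "\<exists>p N. \<forall>z. cmod z = 1 \<longrightarrow> complex_of_real (f z) = poly p z * cnj z ^ N"
  using assms
proof induction
  case (linear f)
  \<comment> \<open>A real linear form is \<open>2 * Re (\<alpha> z)\<close>, that is \<open>(cnj \<alpha> + \<alpha> z\<^sup>2) * cnj z\<close> on the circle.\<close>
  define \<alpha> where "\<alpha> = (of_real (f 1) - \<i> * of_real (f \<i>)) / 2"
  have f: "f z = Re z * f 1 + Im z * f \<i>" for z
  proof -
    interpret bounded_linear f by fact
    have "f z = f (Re z *\<^sub>R 1 + Im z *\<^sub>R \<i>)"
      by (rule arg_cong[where f = f]) (simp add: complex_eq_iff)
    then show ?thesis
      by (simp only: add scaleR real_scaleR_def)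
  qed
  have "complex_of_real (f z) = poly [:cnj \<alpha>, 0, \<alpha>:] z * cnj z ^ 1" if "cmod z = 1" for z
  proof -
    have "z * cnj z = 1"
      using that by (simp flip: complex_norm_square)
    then have "poly [:cnj \<alpha>, 0, \<alpha>:] z * cnj z ^ 1 = cnj \<alpha> * cnj z + \<alpha> * z"
      by (simp add: algebra_simps)
    also have "\<dots> = of_real (f z)"
      unfolding f[of z] by (simp add: \<alpha>_def complex_eq_iff field_simps)
    finally show ?thesis ..
  qed
  then show ?case by blast
next
  case (const c)
  have "\<forall>z. cmod z = 1 \<longrightarrow> complex_of_real c = poly [:of_real c:] z * cnj z ^ 0"
    by simp
  then show ?case by blast
next
  case (add f g)
  then obtain p N q M where
    "\<And>z. cmod z = 1 \<Longrightarrow> complex_of_real (f z) = poly p z * cnj z ^ N"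
    "\<And>z. cmod z = 1 \<Longrightarrow> complex_of_real (g z) = poly q z * cnj z ^ M"
    by metis
  moreover have "z ^ k * cnj z ^ k = 1" if "cmod z = 1" for z k
    using that by (simp flip: power_mult_distrib complex_norm_square)
  ultimately have "complex_of_real (f z + g z) = poly (p * monom 1 M + q * monom 1 N) z * cnj z ^ (N + M)"
    if "cmod z = 1" for z
    using that by (simp add: poly_monom power_add algebra_simps)
  then show ?case by blast
next
  case (mult f g)
  then obtain p N q M where
    "\<And>z. cmod z = 1 \<Longrightarrow> complex_of_real (f z) = poly p z * cnj z ^ N"
    "\<And>z. cmod z = 1 \<Longrightarrow> complex_of_real (g z) = poly q z * cnj z ^ M"
    by metis
  then have "complex_of_real (f z * g z) = poly (p * q) z * cnj z ^ (N + M)" if "cmod z = 1" for z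
    using that by (simp add: power_add)
  then show ?case by blast
qed

lemma space_eq_sphere: "sets M = sets circle \<Longrightarrow> space M = sphere 0 1"
  using sets_eq_imp_space_eq[of M circle] by simp

lemma finite_measure_integrable_continuous_circle:
  fixes f :: "complex \<Rightarrow> 'b :: {banach, second_countable_topology}"
  assumes "finite_measure M" "sets M = sets circle" "continuous_on (sphere 0 1) f"
  shows "integrable M f"
proof -
  interpret finite_measure M by fact
  obtain B where B: "\<And>z. cmod z = 1 \<Longrightarrow> norm (f z) \<le> B"
    using continuous_on_sphere_bounded[OF assms(3)] by blast
  have "f \<in> borel_measurable M"
    using continuous_on_circle_measurable[OF assms(3)] measurable_cong_sets[OF assms(2) refl] by blast
  then show ?thesis
    using B space_eq_sphere[OF assms(2)] by (intro integrable_const_bound[where B = B]) auto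
qed

text \<open>The nonnegative moments determine the negative ones by conjugation, hence the integrals of all
  trigonometric polynomials. By Stone-Weierstrass the integrals of all continuous functions agree, and
  since the indicator of a closed set is a decreasing limit of continuous functions, so do the measures
  of closed sets, which form an intersection-stable generator.\<close>
theorem finite_measure_circle_eqI:
  assumes M: "finite_measure M" "sets M = sets circle"
    and N: "finite_measure N" "sets N = sets circle"
    and eq: "\<And>n. (LINT z|M. z ^ n) = (LINT z|N. z ^ n)"
  shows "M = N"
proof -
  interpret M: finite_measure M by fact
  interpret N: finite_measure N by fact
  have spM: "space M = sphere 0 1" and spN: "space N = sphere 0 1"
    using space_eq_sphere M(2) N(2) by auto
  note intM = finite_measure_integrable_continuous_circle[OF M]
  note intN = finite_measure_integrable_continuous_circle[OF N]

  have mono: "(LINT z|M. z ^ i * cnj z ^ j) = (LINT z|N. z ^ i * cnj z ^ j)" for i j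
  proof -
    have red: "z ^ i * cnj z ^ j = (if j \<le> i then z ^ (i - j) else cnj (z ^ (j - i)))"
      if "cmod z = 1" for z
    proof -
      have *: "z ^ k * cnj z ^ k = 1" for k
        using that by (simp flip: power_mult_distrib complex_norm_square)
      show ?thesis
      proof (cases "j \<le> i")
        case True
        then have "z ^ i = z ^ (i - j) * z ^ j" by (simp flip: power_add)
        then show ?thesis using True *[of j] by (simp add: mult.assoc)
      next
        case False
        then have "cnj z ^ j = cnj z ^ i * cnj z ^ (j - i)" by (simp flip: power_add)
        then show ?thesis using False *[of i] by (simp flip: mult.assoc)
      qed
    qed
    have "(LINT z|L. z ^ i * cnj z ^ j) = 
        (if j \<le> i then (LINT z|L. z ^ (i - j)) else cnj (LINT z|L. z ^ (j - i)))"
      if "space L = sphere 0 1" for L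
    proof -
      have "(LINT z|L. z ^ i * cnj z ^ j) = 
          (LINT z|L. (if j \<le> i then z ^ (i - j) else cnj (z ^ (j - i))))"
        by (rule Bochner_Integration.integral_cong) (use red that in auto)
      then show ?thesis by (cases "j \<le> i") (simp_all del: complex_cnj_power)
    qed
    from this[OF spM] this[OF spN] show ?thesis
      by (simp add: eq)
  qed

  have rpoly: "(LINT z|M. g z) = (LINT z|N. g z)" if "real_polynomial_function g" for g
  proof -
    obtain p k where pk: "cmod z = 1 \<Longrightarrow> complex_of_real (g z) = poly p z * cnj z ^ k" for z
      using real_polynomial_on_circle[OF \<open>real_polynomial_function g\<close>] by blast
    have "complex_of_real (LINT z|L. g z) = (\<Sum>i\<le>degree p. coeff p i * (LINT z|L. z ^ i * cnj z ^ k))"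
      if L: "finite_measure L" "sets L = sets circle" for L
    proof -
      have sp: "space L = sphere 0 1"
        by (rule space_eq_sphere[OF L(2)])
      have "complex_of_real (LINT z|L. g z) = (LINT z|L. complex_of_real (g z))"
        by simp
      also have "\<dots> = (LINT z|L. (\<Sum>i\<le>degree p. coeff p i * (z ^ i * cnj z ^ k)))"
        by (rule Bochner_Integration.integral_cong) 
          (use sp pk in \<open>auto simp: poly_altdef sum_distrib_right mult.assoc\<close>)
      also have "\<dots> = (\<Sum>i\<le>degree p. (LINT z|L. coeff p i * (z ^ i * cnj z ^ k)))"
        by (intro Bochner_Integration.integral_sum finite_measure_integrable_continuous_circle L
            continuous_intros)
      finally show ?thesis by simp
    qed
    from this[OF M] this[OF N] 
    have "complex_of_real (LINT z|M. g z) = complex_of_real (LINT z|N. g z)"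
      by (simp only: mono)
    then show ?thesis
      by (simp only: of_real_eq_iff)
  qed

  have cont: "(LINT z|M. f z) = (LINT z|N. f z)" if f: "continuous_on (sphere 0 1) f" 
    for f :: "complex \<Rightarrow> real"
  proof (rule ccontr)
    \<comment> \<open>The summand 1 makes \<open>K\<close> positive and the final estimate strict.\<close>
    define K where "K = measure M (space M) + measure N (space N) + 1"
    define D where "D = \<bar>(LINT z|M. f z) - (LINT z|N. f z)\<bar>"
    assume "(LINT z|M. f z) \<noteq> (LINT z|N. f z)"
    then have D: "D > 0" by (simp add: D_def)
    have K: "K > 0" unfolding K_def by (intro add_nonneg_pos add_nonneg_nonneg) auto
    obtain g where g: "real_polynomial_function g" "\<And>z. z \<in> sphere 0 1 \<Longrightarrow> \<bar>f z - g z\<bar> < D / K"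
      using Stone_Weierstrass_real_polynomial_function[OF compact_sphere f, of "D / K"] D K by auto
    have gc: "continuous_on (sphere 0 1) g"
      using g(1) continuous_on_polymonial_function real_polynomial_function_eq by blast
    have est: "\<bar>(LINT z|L. f z) - (LINT z|L. g z)\<bar> \<le> D / K * measure L (space L)"
      if L: "finite_measure L" "sets L = sets circle" for L
    proof -
      interpret finite_measure L by fact
      have sp: "space L = sphere 0 1"
        by (rule space_eq_sphere[OF L(2)])
      note int = finite_measure_integrable_continuous_circle[OF L]
      have "\<bar>(LINT z|L. f z) - (LINT z|L. g z)\<bar> = \<bar>LINT z|L. f z - g z\<bar>"
        by (subst Bochner_Integration.integral_diff) (auto intro: int f gc)
      also have "\<dots> \<le> (LINT z|L. \<bar>f z - g z\<bar>)"
        by (rule integral_abs_bound)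
      also have "\<dots> \<le> (LINT z|L. D / K)"
        by (intro integral_mono int continuous_intros f gc) (use sp g(2) in \<open>auto intro: less_imp_le\<close>)
      finally show ?thesis by (simp add: mult.commute)
    qed
    have "D \<le> D / K * measure M (space M) + D / K * measure N (space N)"
      using est[OF M] est[OF N] rpoly[OF g(1)] unfolding D_def by linarith
    also have "\<dots> = D / K * (K - 1)"
      by (simp add: K_def ring_distribs)
    also have "\<dots> < D / K * K"
      using D K by (intro mult_strict_left_mono) auto
    finally show False using K by simp
  qed

  have closed: "measure M (A \<inter> space M) = measure N (A \<inter> space N)" if A: "closed A" for A
  proof (cases "A = {}")
    case False
    define h where "h n z = max 0 (1 - real n * infdist z A)" for n z
    have hc: "continuous_on (sphere 0 1) (h n)" for n
      unfolding h_def by (intro continuous_intros)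
    have lim: "(\<lambda>n. LINT z|L. h n z) \<longlonglongrightarrow> measure L (A \<inter> space L)"
      if L: "finite_measure L" "sets L = sets circle" for L
    proof -
      interpret finite_measure L by fact
      have As: "A \<inter> space L \<in> sets L"
      proof -
        have "space L = sphere 0 1"
          by (rule space_eq_sphere[OF L(2)])
        then show ?thesis
          using A unfolding L(2) sets_circle by (auto simp: sets_restrict_space)
      qed
      have "(\<lambda>n. LINT z|L. h n z) \<longlonglongrightarrow> (LINT z|L. indicator (A \<inter> space L) z)"
      proof (rule integral_dominated_convergence[where w = "\<lambda>_. 1"])
        show "h n \<in> borel_measurable L" for n
          using finite_measure_integrable_continuous_circle[OF L hc] by simp
        show "AE z in L. (\<lambda>n. h n z) \<longlonglongrightarrow> indicator (A \<inter> space L) z"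
        proof (rule AE_I2)
          fix z assume z: "z \<in> space L"
          show "(\<lambda>n. h n z) \<longlonglongrightarrow> indicator (A \<inter> space L) z"
          proof (cases "z \<in> A")
            case True
            then show ?thesis using z by (simp add: h_def)
          next
            case nA: False
            then have pos: "infdist z A > 0"
              using A False infdist_pos_not_in_closed by blast
            obtain k :: nat where k: "1 < real k * infdist z A"
              using pos reals_Archimedean3 by blast
            have "\<forall>\<^sub>F n in sequentially. h n z = 0"
              using eventually_ge_at_top[of k]
            proof eventually_elim
              case (elim n)
              have "real k * infdist z A \<le> real n * infdist z A"
                using elim pos by (intro mult_right_mono) auto
              then show ?case using k by (simp add: h_def)
            qed
            then show ?thesis using nA by (simp add: tendsto_eventually)
          qed
        qed
        show "AE z in L. norm (h n z) \<le> 1" for n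
          by (rule AE_I2) (auto simp: h_def infdist_nonneg)
      qed (use As in auto)
      then show ?thesis using As by simp
    qed
    have "(\<lambda>n. LINT z|M. h n z) \<longlonglongrightarrow> measure N (A \<inter> space N)"
      using lim[OF N] by (simp add: cont[OF hc])
    with lim[OF M] show ?thesis by (rule LIMSEQ_unique)
  qed simp

  \<comment> \<open>Both measures are pushed forward to the plane, whose Borel sets are generated by the closed sets.\<close>
  define em where "em L = distr L borel (\<lambda>z::complex. z)" for L
  have idm: "(\<lambda>z. z) \<in> borel_measurable L" if "sets L = sets circle" for L
    using id_measurable_circle measurable_cong_sets[OF that refl] by blast
  have em_emeasure: "emeasure (em L) A = emeasure L (A \<inter> space L)"
    if "sets L = sets circle" "A \<in> sets borel" for L A
    unfolding em_def using idm[OF that(1)] that(2) by (subst emeasure_distr) auto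
  have "em M = em N"
  proof (rule measure_eqI_generator_eq[where E = "Collect closed" and \<Omega> = UNIV and A = "\<lambda>_. UNIV"])
    show "Int_stable (Collect (closed :: complex set \<Rightarrow> bool))"
      by (auto simp: Int_stable_def)
    show "emeasure (em M) X = emeasure (em N) X" if "X \<in> Collect closed" for X
      using that closed[of X] M N
      by (simp add: em_emeasure M.emeasure_eq_measure N.emeasure_eq_measure)
    show "sets (em M) = sigma_sets UNIV (Collect closed)" "sets (em N) = sigma_sets UNIV (Collect closed)"
      by (simp_all add: em_def borel_eq_closed)
    show "emeasure (em M) UNIV \<noteq> \<infinity>"
      using M(2) by (simp add: em_emeasure)
  qed auto
  show "M = N"
  proof (rule measure_eqI)
    show "sets M = sets N" using M N by simp
    fix A assume A: "A \<in> sets M"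
    then have "A \<subseteq> sphere 0 1" "A \<in> sets borel"
      using M(2) by (auto simp: sets_circle sets_restrict_space)
    then have "A \<inter> space M = A" "A \<inter> space N = A"
      using spM spN by auto
    then show "emeasure M A = emeasure N A"
      using em_emeasure[OF M(2) \<open>A \<in> sets borel\<close>] em_emeasure[OF N(2) \<open>A \<in> sets borel\<close>] \<open>em M = em N\<close>
      by simp
  qed
qed

text \<open>The positive and the negative part of \<open>u\<close> are densities of two finite measures with the same
  moments; so the measures are equal and the two parts agree almost everywhere. As their
  product vanishes, both are zero.\<close>
lemma real_fourier_uniqueness:
  fixes u :: "complex \<Rightarrow> real"
  assumes u: "integrable circle u" and 0: "\<And>n. (LINT z|circle. of_real (u z) * z ^ n) = 0"
  shows "AE z in circle. u z = 0"
proof -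
  have [measurable]: "u \<in> borel_measurable circle" using u by auto
  \<comment> \<open>The values \<open>s = 1\<close> and \<open>s = -1\<close> give the positive and the negative part.\<close>
  define P where "P s = density circle (\<lambda>z. ennreal (max 0 (s * u z)))" for s :: real
  have ip: "integrable circle (\<lambda>z. max 0 (s * u z))" for s
    using u by (intro Bochner_Integration.integrable_max) auto
  have fin: "finite_measure (P s)" for s
  proof (rule finite_measureI)
    have "emeasure (P s) (space (P s)) = (\<integral>\<^sup>+z. ennreal (max 0 (s * u z)) \<partial>circle)"
      unfolding P_def space_density by (subst emeasure_density) (auto intro!: nn_integral_cong simp del: space_circle)
    also have "\<dots> = ennreal (LINT z|circle. max 0 (s * u z))"
      by (rule nn_integral_eq_integral[OF ip]) auto
    finally show "emeasure (P s) (space (P s)) \<noteq> \<infinity>" by simp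
  qed
  have pw: "(LINT z|P s. z ^ n) = (LINT z|circle. max 0 (s * u z) *\<^sub>R z ^ n)" for s n
    unfolding P_def by (rule integral_density) auto
  have ipz: "integrable circle (\<lambda>z. max 0 (s * u z) *\<^sub>R z ^ n)" for s and n
    by (rule Bochner_Integration.integrable_bound[OF ip[of s]]) (auto simp: norm_power)
  have "P 1 = P (- 1)"
  proof (rule finite_measure_circle_eqI[OF fin _ fin])
    fix n
    have "(LINT z|P 1. z ^ n) - (LINT z|P (-1). z ^ n) =
        (LINT z|circle. max 0 (1 * u z) *\<^sub>R z ^ n - max 0 (-1 * u z) *\<^sub>R z ^ n)"
      unfolding pw by (rule Bochner_Integration.integral_diff[symmetric]) (rule ipz)+
    also have "\<dots> = (LINT z|circle. of_real (u z) * z ^ n)"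
      by (rule Bochner_Integration.integral_cong) (auto simp: scaleR_conv_of_real max_def algebra_simps)
    finally show "(LINT z|P 1. z ^ n) = (LINT z|P (-1). z ^ n)"
      using 0 by simp
  qed (auto simp: P_def)
  then have "AE z in circle. ennreal (max 0 (1 * u z)) = ennreal (max 0 (-1 * u z))"
    unfolding P_def by (intro circle.density_unique) auto
  then show ?thesis
    by eventually_elim (auto simp: max_def split: if_splits)
qed

text \<open>Conjugating the hypothesis at \<open>- n\<close> gives the moments of \<open>cnj f\<close>, hence those of the real and the
  imaginary part, and the real case applies to both.\<close>
theorem fourier_uniqueness:
  assumes f: "integrable circle f" and 0: "\<And>k. (LINT z|circle. f z * z powi k) = 0"
  shows "AE z in circle. f z = 0"
proof -
  have [measurable]: "f \<in> borel_measurable circle" "(\<lambda>z. cnj (f z)) \<in> borel_measurable circle"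
    using f complex_integrable_cnj[of circle f] borel_measurable_integrable by metis+
  have ifz: "integrable circle (\<lambda>z. f z * z ^ n)" for n
    by (rule Bochner_Integration.integrable_bound[OF f]) (auto simp: norm_mult norm_power)
  have ifz': "integrable circle (\<lambda>z. cnj (f z) * z ^ n)" for n
    by (rule Bochner_Integration.integrable_bound[OF f]) (auto simp: norm_mult norm_power)
  have p: "(LINT z|circle. f z * z ^ n) = 0" for n
    using 0[of "int n"] by simp
  have q: "(LINT z|circle. cnj (f z) * z ^ n) = 0" for n
  proof -
    have "(LINT z|circle. cnj (f z) * z ^ n) = (LINT z|circle. cnj (f z * z powi (- int n)))"
      by (rule Bochner_Integration.integral_cong)
        (auto simp: power_int_minus cnj_eq_inverse_circle power_inverse)
    also have "\<dots> = 0"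
      unfolding Bochner_Integration.integral_cnj using 0[of "- int n"] by simp
    finally show ?thesis .
  qed
  have "AE z in circle. Re (f z) = 0"
  proof (rule real_fourier_uniqueness)
    fix n
    have "(LINT z|circle. of_real (Re (f z)) * z ^ n) =
        (LINT z|circle. (f z * z ^ n + cnj (f z) * z ^ n) / 2)"
      by (rule Bochner_Integration.integral_cong) (auto simp: complex_add_cnj simp flip: distrib_right)
    also have "\<dots> = 0"
      by (subst Bochner_Integration.integral_divide_zero, subst Bochner_Integration.integral_add[OF ifz ifz'])
        (simp add: p q)
    finally show "(LINT z|circle. of_real (Re (f z)) * z ^ n) = 0" .
  qed (use f in auto)
  moreover have "AE z in circle. Im (f z) = 0"
  proof (rule real_fourier_uniqueness)
    fix n
    have "(LINT z|circle. of_real (Im (f z)) * z ^ n) =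
        (LINT z|circle. (f z * z ^ n - cnj (f z) * z ^ n) * (- \<i> / 2))"
      by (rule Bochner_Integration.integral_cong) (auto simp: complex_eq_iff field_simps)
    also have "\<dots> = 0"
      by (subst Bochner_Integration.integral_mult_left_zero, subst Bochner_Integration.integral_diff[OF ifz ifz'])
        (simp add: p q)
    finally show "(LINT z|circle. of_real (Im (f z)) * z ^ n) = 0" .
  qed (use f in auto)
  ultimately show ?thesis
    by eventually_elim (simp add: complex_eq_iff)
qed

section \<open>The Hilbert space of square integrable functions\<close>

lemma of_real_cmod_sq: "(complex_of_real (cmod z))\<^sup>2 = z * cnj z"
  using complex_norm_square[of z] by simp

definition sqnorm :: "(complex \<Rightarrow> complex) \<Rightarrow> real" where
  "sqnorm f = (LINT z|circle. (cmod (f z))\<^sup>2)"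

lemma sqnorm_nonneg [simp]: "0 \<le> sqnorm f"
  by (simp add: sqnorm_def)

lemma sqnorm_commute: "sqnorm (\<lambda>z. f z - g z) = sqnorm (\<lambda>z. g z - f z)"
  by (simp add: sqnorm_def norm_minus_commute)

lemma circle_prob_sphere [simp]: "measure circle (sphere 0 1) = 1"
  using circle.prob_space by simp

lemma L2_measurable: "f \<in> L2 \<Longrightarrow> f \<in> borel_measurable circle"
  by (simp add: L2_def)

lemma L2_integrable_sq: "f \<in> L2 \<Longrightarrow> integrable circle (\<lambda>z. (cmod (f z))\<^sup>2)"
  by (simp add: L2_def)

lemma L2_boundI:
  assumes "f \<in> borel_measurable circle" "integrable circle g" "AE z in circle. (cmod (f z))\<^sup>2 \<le> g z"
  shows "f \<in> L2"
proof -
  note [measurable] = assms(1)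
  have "integrable circle (\<lambda>z. (cmod (f z))\<^sup>2)"
    by (rule Bochner_Integration.integrable_bound[OF assms(2)])
      (use assms(3) in \<open>auto elim!: eventually_mono\<close>)
  then show ?thesis using assms(1) by (simp add: L2_def)
qed

lemma continuous_on_circle_L2: "continuous_on (sphere 0 1) f \<Longrightarrow> f \<in> L2"
  unfolding L2_def
  by (auto intro!: continuous_on_circle_measurable continuous_on_circle_integrable continuous_intros)

lemma L2_zero: "(\<lambda>z. 0) \<in> L2"
  by (rule continuous_on_circle_L2) simp

lemma cmod_add_sq_le: "(cmod (x + y))\<^sup>2 \<le> 2 * (cmod x)\<^sup>2 + 2 * (cmod y)\<^sup>2"
proof -
  have "(cmod (x + y))\<^sup>2 \<le> (cmod x + cmod y)\<^sup>2"
    by (intro power_mono norm_triangle_ineq) auto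
  also have "\<dots> \<le> 2 * (cmod x)\<^sup>2 + 2 * (cmod y)\<^sup>2"
    using zero_le_power2[of "cmod x - cmod y"] by (simp add: power2_eq_square algebra_simps)
  finally show ?thesis .
qed

lemma L2_add:
  assumes "f \<in> L2" "g \<in> L2" shows "(\<lambda>z. f z + g z) \<in> L2"
proof (rule L2_boundI)
  show "(\<lambda>z. f z + g z) \<in> borel_measurable circle"
    using L2_measurable[OF assms(1)] L2_measurable[OF assms(2)] by measurable
  show "integrable circle (\<lambda>z. 2 * (cmod (f z))\<^sup>2 + 2 * (cmod (g z))\<^sup>2)"
    using L2_integrable_sq[OF assms(1)] L2_integrable_sq[OF assms(2)] by auto
qed (simp add: cmod_add_sq_le)

lemma L2_scale: "f \<in> L2 \<Longrightarrow> (\<lambda>z. c * f z) \<in> L2"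
  by (auto simp: L2_def norm_mult power_mult_distrib)

lemma L2_diff: "f \<in> L2 \<Longrightarrow> g \<in> L2 \<Longrightarrow> (\<lambda>z. f z - g z) \<in> L2"
  using L2_add[of f "\<lambda>z. (-1) * g z"] L2_scale[of g "-1"] by simp

lemma L2_sum: "(\<And>i. i \<in> A \<Longrightarrow> u i \<in> L2) \<Longrightarrow> (\<lambda>z. \<Sum>i\<in>A. u i z) \<in> L2"
  by (induction A rule: infinite_finite_induct) (auto intro: L2_zero L2_add)

lemma L2_cnj: "f \<in> L2 \<Longrightarrow> (\<lambda>z. cnj (f z)) \<in> L2"
  by (auto simp: L2_def)

lemma L2_mult_Linf:
  assumes "\<phi> \<in> Linf" "f \<in> L2" shows "(\<lambda>z. \<phi> z * f z) \<in> L2"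
proof -
  obtain B where B: "AE z in circle. cmod (\<phi> z) \<le> B"
    using assms(1) by (auto simp: Linf_def)
  show ?thesis
  proof (rule L2_boundI)
    show "(\<lambda>z. \<phi> z * f z) \<in> borel_measurable circle"
      using L2_measurable[OF assms(2)] assms(1) by (auto simp: Linf_def)
    show "integrable circle (\<lambda>z. B\<^sup>2 * (cmod (f z))\<^sup>2)"
      using L2_integrable_sq[OF assms(2)] by auto
    show "AE z in circle. (cmod (\<phi> z * f z))\<^sup>2 \<le> B\<^sup>2 * (cmod (f z))\<^sup>2"
      using B by eventually_elim (auto simp: norm_mult power_mult_distrib intro!: mult_right_mono power_mono)
  qed
qed

lemma Linf_L2: "\<phi> \<in> Linf \<Longrightarrow> \<phi> \<in> L2"
  using L2_mult_Linf[of \<phi> "\<lambda>_. 1"] continuous_on_circle_L2[of "\<lambda>_. 1"] by simp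

lemma Linf_cnj: "\<phi> \<in> Linf \<Longrightarrow> (\<lambda>z. cnj (\<phi> z)) \<in> Linf"
  using L2_measurable[OF L2_cnj[OF Linf_L2, of \<phi>]] by (auto simp: Linf_def)

lemma sqnorm_cong_AE:
  assumes "f \<in> borel_measurable circle" "g \<in> borel_measurable circle" "AE z in circle. f z = g z"
  shows "sqnorm f = sqnorm g"
proof -
  note [measurable] = assms(1,2)
  show ?thesis
    unfolding sqnorm_def
    by (rule integral_cong_AE) (use assms(3) in \<open>auto elim!: eventually_mono\<close>)
qed

lemma sqnorm_eq_0_iff: "f \<in> L2 \<Longrightarrow> sqnorm f = 0 \<longleftrightarrow> (AE z in circle. f z = 0)"
  unfolding sqnorm_def
  by (subst integral_nonneg_eq_0_iff_AE) (auto intro: L2_integrable_sq)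

lemma sqnorm_scale: "sqnorm (\<lambda>z. c * f z) = (cmod c)\<^sup>2 * sqnorm f"
  by (simp add: sqnorm_def norm_mult power_mult_distrib)

lemma sqnorm_add_le:
  assumes "f \<in> L2" "g \<in> L2"
  shows "sqnorm (\<lambda>z. f z + g z) \<le> 2 * sqnorm f + 2 * sqnorm g"
proof -
  note [simp] = L2_integrable_sq[OF assms(1)] L2_integrable_sq[OF assms(2)]
    L2_integrable_sq[OF L2_add[OF assms]]
  have "sqnorm (\<lambda>z. f z + g z) \<le> (LINT z|circle. 2 * (cmod (f z))\<^sup>2 + 2 * (cmod (g z))\<^sup>2)"
    unfolding sqnorm_def by (intro integral_mono) (auto simp: cmod_add_sq_le)
  also have "\<dots> = 2 * sqnorm f + 2 * sqnorm g"
    unfolding sqnorm_def by (subst Bochner_Integration.integral_add) auto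
  finally show ?thesis .
qed

lemma sqnorm_triangle_diff:
  assumes "f \<in> L2" "g \<in> L2" "h \<in> L2"
  shows "sqnorm (\<lambda>z. f z - h z) \<le> 2 * sqnorm (\<lambda>z. f z - g z) + 2 * sqnorm (\<lambda>z. g z - h z)"
  using sqnorm_add_le[OF L2_diff[OF assms(1,2)] L2_diff[OF assms(2,3)]] by simp

lemma L2_mult_integrable:
  assumes "f \<in> L2" "g \<in> L2" shows "integrable circle (\<lambda>z. f z * g z)"
proof (rule Bochner_Integration.integrable_bound)
  show "integrable circle (\<lambda>z. (cmod (f z))\<^sup>2 + (cmod (g z))\<^sup>2)"
    using L2_integrable_sq[OF assms(1)] L2_integrable_sq[OF assms(2)] by auto
  show "(\<lambda>z. f z * g z) \<in> borel_measurable circle"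
    using L2_measurable[OF assms(1)] L2_measurable[OF assms(2)] by measurable
  have "norm (f z * g z) \<le> norm ((cmod (f z))\<^sup>2 + (cmod (g z))\<^sup>2)" for z
  proof -
    have "norm (f z * g z) \<le> 2 * cmod (f z) * cmod (g z)"
      by (simp add: norm_mult)
    also have "\<dots> \<le> (cmod (f z))\<^sup>2 + (cmod (g z))\<^sup>2"
      by (rule sum_squares_bound)
    finally show ?thesis by simp
  qed
  then show "AE z in circle. norm (f z * g z) \<le> norm ((cmod (f z))\<^sup>2 + (cmod (g z))\<^sup>2)"
    by simp
qed

lemma L2_inner_integrable:
  "f \<in> L2 \<Longrightarrow> g \<in> L2 \<Longrightarrow> integrable circle (\<lambda>z. f z * cnj (g z))"
  by (intro L2_mult_integrable L2_cnj)

lemma L2_integrable: "f \<in> L2 \<Longrightarrow> integrable circle f"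
  using L2_mult_integrable[of f "\<lambda>_. 1"] continuous_on_circle_L2[of "\<lambda>_. 1"] by simp

lemma inner_L2_commute: "inner_L2 g f = cnj (inner_L2 f g)"
  unfolding inner_L2_def by (subst Bochner_Integration.integral_cnj[symmetric]) (simp add: mult.commute)

lemma inner_L2_self: "inner_L2 f f = of_real (sqnorm f)"
  unfolding inner_L2_def sqnorm_def
  by (subst integral_complex_of_real[symmetric]) (simp add: of_real_cmod_sq)

lemma inner_L2_add_left:
  "f \<in> L2 \<Longrightarrow> g \<in> L2 \<Longrightarrow> h \<in> L2 \<Longrightarrow> inner_L2 (\<lambda>z. f z + g z) h = inner_L2 f h + inner_L2 g h"
  unfolding inner_L2_def
  by (subst Bochner_Integration.integral_add[symmetric]) (auto intro: L2_inner_integrable simp: ring_distribs)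

lemma inner_L2_diff_left:
  "f \<in> L2 \<Longrightarrow> g \<in> L2 \<Longrightarrow> h \<in> L2 \<Longrightarrow> inner_L2 (\<lambda>z. f z - g z) h = inner_L2 f h - inner_L2 g h"
  unfolding inner_L2_def
  by (subst Bochner_Integration.integral_diff[symmetric]) (auto intro: L2_inner_integrable simp: ring_distribs)

lemma inner_L2_scale_left: "inner_L2 (\<lambda>z. c * f z) g = c * inner_L2 f g"
  unfolding inner_L2_def by (simp add: mult.assoc)

lemma inner_L2_scale_right: "inner_L2 f (\<lambda>z. c * g z) = cnj c * inner_L2 f g"
  using inner_L2_scale_left[of c g f] inner_L2_commute[of f] by simp

lemma inner_L2_zero_left [simp]: "inner_L2 (\<lambda>z. 0) g = 0"
  by (simp add: inner_L2_def)

lemma inner_L2_sum_left: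
  assumes "\<And>i. i \<in> A \<Longrightarrow> u i \<in> L2" "g \<in> L2"
  shows "inner_L2 (\<lambda>z. \<Sum>i\<in>A. u i z) g = (\<Sum>i\<in>A. inner_L2 (u i) g)"
  using assms by (induction A rule: infinite_finite_induct) (auto simp: inner_L2_add_left L2_sum)

lemma inner_L2_cong_AE:
  assumes "f \<in> borel_measurable circle" "f' \<in> borel_measurable circle" "g \<in> borel_measurable circle"
    "AE z in circle. f z = f' z"
  shows "inner_L2 f g = inner_L2 f' g"
proof -
  note [measurable] = assms(1-3)
  show ?thesis
    unfolding inner_L2_def
    by (rule integral_cong_AE) (use assms(4) in \<open>auto elim!: eventually_mono\<close>)
qed

lemma sqnorm_diff:
  assumes "f \<in> L2" "g \<in> L2"
  shows "sqnorm (\<lambda>z. f z - g z) = sqnorm f - 2 * Re (inner_L2 f g) + sqnorm g"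
proof -
  have "complex_of_real (sqnorm (\<lambda>z. f z - g z)) = inner_L2 (\<lambda>z. f z - g z) (\<lambda>z. f z - g z)"
    by (rule inner_L2_self[symmetric])
  also have "\<dots> = (inner_L2 f (\<lambda>z. f z - g z) - inner_L2 g (\<lambda>z. f z - g z))"
    by (rule inner_L2_diff_left[OF assms L2_diff[OF assms]])
  also have "inner_L2 f (\<lambda>z. f z - g z) = inner_L2 f f - inner_L2 f g"
    using inner_L2_diff_left[OF assms assms(1)] inner_L2_commute[of f "\<lambda>z. f z - g z"]
      inner_L2_commute[of f g] inner_L2_commute[of f f] by simp
  also have "inner_L2 g (\<lambda>z. f z - g z) = inner_L2 g f - inner_L2 g g"
    using inner_L2_diff_left[OF assms assms(2)] inner_L2_commute[of g "\<lambda>z. f z - g z"]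
      inner_L2_commute[of g f] inner_L2_commute[of g g] by simp
  also have "inner_L2 g f = cnj (inner_L2 f g)"
    by (rule inner_L2_commute)
  finally have "Re (complex_of_real (sqnorm (\<lambda>z. f z - g z))) = 
      Re (inner_L2 f f - inner_L2 f g - (cnj (inner_L2 f g) - inner_L2 g g))"
    by (rule arg_cong)
  then show ?thesis
    by (simp add: inner_L2_self)
qed

lemma Cauchy_Schwarz_L2:
  assumes "f \<in> L2" "g \<in> L2"
  shows "(cmod (inner_L2 f g))\<^sup>2 \<le> sqnorm f * sqnorm g"
proof (cases "sqnorm g = 0")
  case True
  then have "AE z in circle. g z = 0"
    using sqnorm_eq_0_iff assms by blast
  then have "inner_L2 g f = inner_L2 (\<lambda>z. 0) f"
    using assms by (intro inner_L2_cong_AE) (auto intro: L2_measurable)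
  then show ?thesis
    using True inner_L2_commute[of f g] by simp
next
  case False
  then have pos: "sqnorm g > 0"
    using sqnorm_nonneg[of g] by linarith
  \<comment> \<open>The multiple of \<open>g\<close> closest to \<open>f\<close>.\<close>
  define c where "c = inner_L2 f g / of_real (sqnorm g)"
  have "0 \<le> sqnorm (\<lambda>z. f z - c * g z)"
    by simp
  also have "\<dots> = sqnorm f - 2 * Re (cnj c * inner_L2 f g) + (cmod c)\<^sup>2 * sqnorm g"
    using assms by (subst sqnorm_diff) (auto intro: L2_scale simp: inner_L2_scale_right sqnorm_scale)
  also have "cnj c * inner_L2 f g = of_real ((cmod (inner_L2 f g))\<^sup>2 / sqnorm g)"
    by (simp add: c_def of_real_cmod_sq mult.commute)
  also have "(cmod c)\<^sup>2 * sqnorm g = (cmod (inner_L2 f g))\<^sup>2 / sqnorm g"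
    using pos by (simp add: c_def norm_divide power_divide power2_eq_square)
  finally have "(cmod (inner_L2 f g))\<^sup>2 / sqnorm g \<le> sqnorm f"
    by simp
  then show ?thesis
    using pos by (simp add: pos_divide_le_eq)
qed

text \<open>Convergence along an arbitrary filter, since it is needed for partial sums of series as well as for
  the dilates \<open>z \<mapsto> F (r z)\<close> with \<open>r\<close> tending to 1.\<close>
lemma inner_L2_tendsto:
  assumes "\<forall>\<^sub>F i in F. u i \<in> L2" "f \<in> L2" "g \<in> L2"
    and "((\<lambda>i. sqnorm (\<lambda>z. f z - u i z)) \<longlongrightarrow> 0) F"
  shows "((\<lambda>i. inner_L2 (u i) g) \<longlongrightarrow> inner_L2 f g) F"
proof -
  have "((\<lambda>i. sqrt (sqnorm (\<lambda>z. f z - u i z) * sqnorm g)) \<longlongrightarrow> sqrt (0 * sqnorm g)) F"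
    by (intro tendsto_intros assms)
  then have lim: "((\<lambda>i. sqrt (sqnorm (\<lambda>z. f z - u i z) * sqnorm g)) \<longlongrightarrow> 0) F"
    by simp
  have "\<forall>\<^sub>F i in F. norm (inner_L2 (u i) g - inner_L2 f g) \<le> sqrt (sqnorm (\<lambda>z. f z - u i z) * sqnorm g)"
    using assms(1)
  proof eventually_elim
    case (elim i)
    have "(cmod (inner_L2 (\<lambda>z. f z - u i z) g))\<^sup>2 \<le> sqnorm (\<lambda>z. f z - u i z) * sqnorm g"
      by (intro Cauchy_Schwarz_L2 L2_diff assms elim)
    then have "cmod (inner_L2 (\<lambda>z. f z - u i z) g) \<le> sqrt (sqnorm (\<lambda>z. f z - u i z) * sqnorm g)"
      by (rule real_le_rsqrt)
    then show ?case
      using inner_L2_diff_left[OF assms(2) elim assms(3)] by (simp add: norm_minus_commute)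
  qed
  then have "((\<lambda>i. inner_L2 (u i) g - inner_L2 f g) \<longlongrightarrow> 0) F"
    by (rule Lim_null_comparison[OF _ lim])
  then show ?thesis
    by (rule LIM_zero_cancel)
qed

lemma sums_L2_sqnorm:
  "sums_L2 u f \<longleftrightarrow> (\<forall>m. u m \<in> L2) \<and> f \<in> L2 \<and> (\<lambda>N. sqnorm (\<lambda>z. f z - (\<Sum>m<N. u m z))) \<longlonglongrightarrow> 0"
  by (simp add: sums_L2_def sqnorm_def)

lemma sums_L2_inner:
  assumes "sums_L2 u f" "g \<in> L2"
  shows "(\<lambda>m. inner_L2 (u m) g) sums inner_L2 f g"
proof -
  have "(\<lambda>N. inner_L2 (\<lambda>z. \<Sum>m<N. u m z) g) \<longlonglongrightarrow> inner_L2 f g"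
    using assms by (intro inner_L2_tendsto always_eventually allI L2_sum) (auto simp: sums_L2_sqnorm)
  then show ?thesis
    using assms by (simp add: sums_def sums_L2_sqnorm inner_L2_sum_left)
qed

lemma sums_L2_cong_AE:
  assumes "sums_L2 u f" "g \<in> L2" "AE z in circle. f z = g z"
  shows "sums_L2 u g"
proof -
  have "sqnorm (\<lambda>z. g z - (\<Sum>m<N. u m z)) = sqnorm (\<lambda>z. f z - (\<Sum>m<N. u m z))" for N
    using assms by (intro sqnorm_cong_AE L2_measurable L2_diff L2_sum) (auto simp: sums_L2_sqnorm)
  then show ?thesis using assms by (auto simp: sums_L2_sqnorm)
qed

lemma sums_L2_unique_AE:
  assumes "sums_L2 u f" "sums_L2 u g"
  shows "AE z in circle. f z = g z"
proof -
  have L2: "f \<in> L2" "g \<in> L2" "\<And>m. u m \<in> L2"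
    using assms by (auto simp: sums_L2_sqnorm)
  let ?S = "\<lambda>N z. \<Sum>m<N. u m z"
  have "(\<lambda>N. 2 * sqnorm (\<lambda>z. f z - ?S N z) + 2 * sqnorm (\<lambda>z. g z - ?S N z)) \<longlonglongrightarrow> 2 * 0 + 2 * 0"
    using assms by (intro tendsto_intros) (auto simp: sums_L2_sqnorm)
  moreover have "sqnorm (\<lambda>z. f z - g z) \<le> 2 * sqnorm (\<lambda>z. f z - ?S N z) + 2 * sqnorm (\<lambda>z. g z - ?S N z)" for N
    using sqnorm_triangle_diff[OF L2(1) L2_sum L2(2), of "{..<N}" u] L2(3)
      sqnorm_commute[of "?S N" g] by simp
  ultimately have "sqnorm (\<lambda>z. f z - g z) \<le> 2 * 0 + 2 * 0"
    by (intro tendsto_lowerbound) auto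
  then have "sqnorm (\<lambda>z. f z - g z) = 0"
    using sqnorm_nonneg[of "\<lambda>z. f z - g z"] by linarith
  then show ?thesis
    using sqnorm_eq_0_iff[OF L2_diff[OF L2(1,2)]] by simp
qed

text \<open>The Riesz-Fischer argument. Along a subsequence the increments have norms at most \<open>2 ^ (- k)\<close>,
  so they are absolutely summable almost everywhere and the subsequence has a pointwise limit \<open>f\<close>;
  Fatou's lemma bounds the distance from \<open>f\<close> to the original sequence.\<close>
theorem L2_complete:
  assumes F: "\<And>n. F n \<in> L2"
    and Cauchy: "\<And>e. e > 0 \<Longrightarrow> \<exists>N. \<forall>m\<ge>N. \<forall>n\<ge>N. sqnorm (\<lambda>z. F m z - F n z) < e"
  shows "\<exists>f\<in>L2. (\<lambda>n. sqnorm (\<lambda>z. f z - F n z)) \<longlonglongrightarrow> 0"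
proof -
  have nn: "(\<integral>\<^sup>+z. ennreal ((cmod (h z))\<^sup>2) \<partial>circle) = ennreal (sqnorm h)" if "h \<in> L2" for h
    unfolding sqnorm_def by (rule nn_integral_eq_integral[OF L2_integrable_sq[OF that]]) auto
  note [measurable] = L2_measurable[OF F]
  have "\<exists>N. \<forall>m\<ge>N. \<forall>n\<ge>N. sqnorm (\<lambda>z. F m z - F n z) < (1/4)^k" for k :: nat
    by (rule Cauchy) simp
  then obtain N where N: "\<And>k m n. m \<ge> N k \<Longrightarrow> n \<ge> N k \<Longrightarrow> sqnorm (\<lambda>z. F m z - F n z) < (1/4)^k"
    by metis
  \<comment> \<open>The sum of the bounds is above each of them and monotone; adding \<open>k\<close> makes \<open>r\<close> unbounded.\<close>
  define r where "r k = k + (\<Sum>j\<le>k. N j)" for k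
  have rN: "r k \<ge> N k" "r (Suc k) \<ge> N k" "r k \<ge> k" for k
    using member_le_sum[of k "{..k}" N] by (auto simp: r_def)
  define G where "G k = F (r k)" for k
  define D where "D k z = G (Suc k) z - G k z" for k z
  have DL2: "D k \<in> L2" for k
    unfolding D_def G_def by (intro L2_diff F)
  have [measurable]: "D k \<in> borel_measurable circle" "G k \<in> borel_measurable circle" for k
    unfolding D_def G_def by measurable
  have D: "sqnorm (D k) \<le> (1/4)^k" for k
    using N[of k "r (Suc k)" "r k"] rN unfolding D_def G_def by (simp add: less_imp_le)
  have D1: "(\<integral>\<^sup>+z. ennreal (cmod (D k z)) \<partial>circle) \<le> ennreal (2 * (1/2)^k)" for k
  proof -
    have "(\<integral>\<^sup>+z. ennreal (cmod (D k z)) \<partial>circle) = ennreal (LINT z|circle. cmod (D k z))"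
      by (intro nn_integral_eq_integral integrable_norm L2_integrable DL2) auto
    also have "(LINT z|circle. cmod (D k z)) \<le> (LINT z|circle. 2^k * (cmod (D k z))\<^sup>2 + (1/2)^k)"
    proof (rule integral_mono)
      show "integrable circle (\<lambda>z. cmod (D k z))"
        by (intro integrable_norm L2_integrable DL2)
      show "integrable circle (\<lambda>z. 2^k * (cmod (D k z))\<^sup>2 + (1/2)^k)"
        using L2_integrable_sq[OF DL2] by auto
      fix z
      \<comment> \<open>Arithmetic-geometric mean inequality, weighted so that both integrals are of order \<open>2 ^ (- k)\<close>.\<close>
      show "cmod (D k z) \<le> 2^k * (cmod (D k z))\<^sup>2 + (1/2)^k"
      proof -
        define x :: real where "x = 2 ^ k"
        have x: "x > 0" "(1/2)^k = 1 / x" by (simp_all add: x_def power_one_over)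
        have "0 \<le> (x * cmod (D k z) - 1)\<^sup>2 + x * cmod (D k z)" using x by simp
        then have "x * cmod (D k z) \<le> x * (x * (cmod (D k z))\<^sup>2 + 1 / x)"
          using x by (simp add: power2_eq_square algebra_simps)
        then show ?thesis using x(1) unfolding x(2) x_def[symmetric] by (simp only: mult_le_cancel_left_pos)
      qed
    qed
    also have "\<dots> = 2^k * sqnorm (D k) + (1/2)^k"
      unfolding sqnorm_def using L2_integrable_sq[OF DL2] 
      by (subst Bochner_Integration.integral_add) (auto simp: circle.prob_space)
    also have "\<dots> \<le> 2^k * (1/4)^k + (1/2)^k"
      using D[of k] by simp
    also have "\<dots> = 2 * (1/2)^k"
      by (simp flip: power_mult_distrib)
    finally show ?thesis by (simp add: ennreal_leI)
  qed
  have "(\<integral>\<^sup>+z. (\<Sum>k. ennreal (cmod (D k z))) \<partial>circle) = (\<Sum>k. \<integral>\<^sup>+z. ennreal (cmod (D k z)) \<partial>circle)"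
    by (rule nn_integral_suminf) auto
  also have "\<dots> \<le> (\<Sum>k. ennreal (2 * (1/2)^k))"
    by (intro suminf_le D1) auto
  also have "\<dots> = ennreal (\<Sum>k. 2 * (1/2)^k)"
    by (rule suminf_ennreal2) (auto intro: summable_mult)
  also have "\<dots> < \<infinity>" by simp
  finally have "AE z in circle. (\<Sum>k. ennreal (cmod (D k z))) \<noteq> \<infinity>"
    by (intro nn_integral_PInf_AE) auto
  then have conv: "AE z in circle. convergent (\<lambda>k. G k z)"
  proof eventually_elim
    case (elim z)
    then have "summable (\<lambda>k. cmod (D k z))"
      by (intro summable_suminf_not_top) auto
    then have "summable (\<lambda>k. D k z)"
      by (rule summable_norm_cancel)
    then have "convergent (\<lambda>n. G 0 z + (\<Sum>k<n. D k z))"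
      by (intro convergent_add) (auto simp: summable_iff_convergent convergent_const)
    also have "(\<lambda>n. G 0 z + (\<Sum>k<n. D k z)) = (\<lambda>n. G n z)"
      unfolding D_def by (subst sum_lessThan_telescope) simp
    finally show ?case .
  qed
  define f where "f z = lim (\<lambda>k. G k z)" for z
  have fm [measurable]: "f \<in> borel_measurable circle"
    unfolding f_def by measurable
  have Gf: "AE z in circle. (\<lambda>k. G k z) \<longlonglongrightarrow> f z"
    using conv unfolding f_def by eventually_elim (simp add: convergent_LIMSEQ_iff)
  have fatou: "(\<integral>\<^sup>+z. ennreal ((cmod (f z - F n z))\<^sup>2) \<partial>circle) \<le> ennreal e"
    if e: "e > 0" and M: "\<And>m. m \<ge> M \<Longrightarrow> sqnorm (\<lambda>z. F m z - F n z) < e" for e M n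
  proof -
    have "(\<integral>\<^sup>+z. ennreal ((cmod (f z - F n z))\<^sup>2) \<partial>circle) =
        (\<integral>\<^sup>+z. liminf (\<lambda>k. ennreal ((cmod (G k z - F n z))\<^sup>2)) \<partial>circle)"
    proof (rule nn_integral_cong_AE)
      show "AE z in circle. ennreal ((cmod (f z - F n z))\<^sup>2) = 
          liminf (\<lambda>k. ennreal ((cmod (G k z - F n z))\<^sup>2))"
        using Gf
      proof eventually_elim
        case (elim z)
        have "(\<lambda>k. ennreal ((cmod (G k z - F n z))\<^sup>2)) \<longlonglongrightarrow> ennreal ((cmod (f z - F n z))\<^sup>2)"
          by (intro tendsto_ennrealI tendsto_intros elim)
        then show ?case
          by (rule lim_imp_Liminf[symmetric, OF sequentially_bot])
      qed
    qed
    also have "\<dots> \<le> liminf (\<lambda>k. \<integral>\<^sup>+z. ennreal ((cmod (G k z - F n z))\<^sup>2) \<partial>circle)"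
      by (rule nn_integral_liminf) measurable
    also have "\<dots> \<le> ennreal e"
    proof (rule Liminf_le)
      show "\<forall>\<^sub>F k in sequentially. (\<integral>\<^sup>+z. ennreal ((cmod (G k z - F n z))\<^sup>2) \<partial>circle) \<le> ennreal e"
        using eventually_ge_at_top[of M]
      proof eventually_elim
        case (elim k)
        then have "r k \<ge> M" using rN(3)[of k] by linarith
        then show ?case
          unfolding G_def nn[OF L2_diff[OF F F]] by (intro ennreal_leI less_imp_le[OF M])
      qed
    qed simp
    finally show ?thesis .
  qed
  have L2d: "(\<lambda>z. f z - F n z) \<in> L2 \<and> sqnorm (\<lambda>z. f z - F n z) \<le> e"
    if e: "e > 0" and M: "\<And>m. m \<ge> M \<Longrightarrow> sqnorm (\<lambda>z. F m z - F n z) < e" for e M n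
  proof
    have "integrable circle (\<lambda>z. (cmod (f z - F n z))\<^sup>2)"
      using le_less_trans[OF fatou[OF e M] ennreal_less_top] by (intro integrableI_bounded) auto
    then show 1: "(\<lambda>z. f z - F n z) \<in> L2"
      by (auto simp: L2_def)
    show "sqnorm (\<lambda>z. f z - F n z) \<le> e"
      using fatou[OF e M] e unfolding nn[OF 1] by simp
  qed
  obtain M0 where M0: "\<And>m n. m \<ge> M0 \<Longrightarrow> n \<ge> M0 \<Longrightarrow> sqnorm (\<lambda>z. F m z - F n z) < 1"
    using Cauchy[of 1] by auto
  have "(\<lambda>z. (f z - F M0 z) + F M0 z) \<in> L2"
    using L2d[of 1 M0 M0] M0 by (intro L2_add F) auto
  then have "f \<in> L2" by simp
  moreover have "(\<lambda>n. sqnorm (\<lambda>z. f z - F n z)) \<longlonglongrightarrow> 0"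
  proof (rule LIMSEQ_I)
    fix e :: real assume "e > 0"
    then have "e / 2 > 0" by simp
    from Cauchy[OF this] obtain M where M: "\<And>m n. m \<ge> M \<Longrightarrow> n \<ge> M \<Longrightarrow> sqnorm (\<lambda>z. F m z - F n z) < e / 2"
      by blast
    have "norm (sqnorm (\<lambda>z. f z - F n z) - 0) < e" if "n \<ge> M" for n
      using L2d[of "e/2" M n] M that \<open>e > 0\<close> by simp
    then show "\<exists>no. \<forall>n\<ge>no. norm (sqnorm (\<lambda>z. f z - F n z) - 0) < e" by blast
  qed
  ultimately show ?thesis by blast
qed

definition orthonormal_L2 :: "(nat \<Rightarrow> complex \<Rightarrow> complex) \<Rightarrow> bool" where
  "orthonormal_L2 b \<longleftrightarrow> (\<forall>m. b m \<in> L2) \<and> (\<forall>m n. inner_L2 (b m) (b n) = (if m = n then 1 else 0))"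

lemma orthonormal_sqnorm_sum:
  assumes "orthonormal_L2 b" "finite A"
  shows "sqnorm (\<lambda>z. \<Sum>m\<in>A. \<mu> m * b m z) = (\<Sum>m\<in>A. (cmod (\<mu> m))\<^sup>2)"
proof -
  let ?S = "\<lambda>z. \<Sum>m\<in>A. \<mu> m * b m z"
  have b: "b m \<in> L2" for m using assms by (auto simp: orthonormal_L2_def)
  have S: "?S \<in> L2" by (intro L2_sum L2_scale b)
  have coeff: "inner_L2 ?S (b n) = (if n \<in> A then \<mu> n else 0)" for n
  proof -
    have "inner_L2 ?S (b n) = (\<Sum>m\<in>A. inner_L2 (\<lambda>z. \<mu> m * b m z) (b n))"
      by (intro inner_L2_sum_left L2_scale b)
    also have "\<dots> = (\<Sum>m\<in>A. if m = n then \<mu> m else 0)"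
      using assms(1) by (intro sum.cong) (auto simp: inner_L2_scale_left orthonormal_L2_def)
    finally show ?thesis using assms(2) by simp
  qed
  have "complex_of_real (sqnorm ?S) = inner_L2 ?S ?S"
    by (rule inner_L2_self[symmetric])
  also have "\<dots> = (\<Sum>m\<in>A. \<mu> m * cnj (inner_L2 ?S (b m)))"
    by (subst inner_L2_sum_left) (auto intro: L2_scale b S simp: inner_L2_scale_left inner_L2_commute[of "b _" ?S])
  also have "\<dots> = complex_of_real (\<Sum>m\<in>A. (cmod (\<mu> m))\<^sup>2)"
    by (simp add: coeff of_real_cmod_sq)
  finally show ?thesis by (simp only: of_real_eq_iff)
qed

lemma orthonormal_sums_coeff:
  assumes "orthonormal_L2 b" "sums_L2 (\<lambda>m z. \<mu> m * b m z) f"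
  shows "inner_L2 f (b n) = \<mu> n"
proof -
  have "(\<lambda>m. inner_L2 (\<lambda>z. \<mu> m * b m z) (b n)) sums inner_L2 f (b n)"
    by (rule sums_L2_inner) (use assms in \<open>auto simp: orthonormal_L2_def\<close>)
  also have "(\<lambda>m. inner_L2 (\<lambda>z. \<mu> m * b m z) (b n)) = (\<lambda>m. if m = n then \<mu> m else 0)"
    using assms(1) by (auto simp: inner_L2_scale_left orthonormal_L2_def)
  finally show ?thesis
    using sums_single[of n \<mu>] sums_unique2 by blast
qed

lemma orthonormal_Parseval:
  assumes "orthonormal_L2 b" "sums_L2 (\<lambda>m z. \<mu> m * b m z) f"
  shows "(\<lambda>m. (cmod (\<mu> m))\<^sup>2) sums sqnorm f"
proof -
  have "(\<lambda>m. inner_L2 (\<lambda>z. \<mu> m * b m z) f) sums inner_L2 f f"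
    by (rule sums_L2_inner) (use assms in \<open>auto simp: sums_L2_def\<close>)
  also have "(\<lambda>m. inner_L2 (\<lambda>z. \<mu> m * b m z) f) = (\<lambda>m. complex_of_real ((cmod (\<mu> m))\<^sup>2))"
    using orthonormal_sums_coeff[OF assms] inner_L2_commute[of "b _" f]
    by (simp add: inner_L2_scale_left of_real_cmod_sq)
  finally show ?thesis
    by (simp only: inner_L2_self sums_of_real_iff)
qed

text \<open>The squared distance from \<open>f\<close> to a partial sum of its expansion is nonnegative, and by orthogonality
  it is the squared norm of \<open>f\<close> minus a partial sum of this series.\<close>
lemma orthonormal_Bessel:
  assumes "orthonormal_L2 b" "f \<in> L2"
  shows "summable (\<lambda>m. (cmod (inner_L2 f (b m)))\<^sup>2)"
proof (rule bounded_imp_summable)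
  fix n
  let ?S = "\<lambda>z. \<Sum>m\<le>n. inner_L2 f (b m) * b m z"
  have b: "b m \<in> L2" for m using assms by (auto simp: orthonormal_L2_def)
  have S: "?S \<in> L2" by (intro L2_sum L2_scale b)
  have "inner_L2 ?S f = of_real (\<Sum>m\<le>n. (cmod (inner_L2 f (b m)))\<^sup>2)"
    using assms(2) by (subst inner_L2_sum_left)
      (auto intro: L2_scale b S simp: inner_L2_scale_left inner_L2_commute[of "b _" f] of_real_cmod_sq)
  then have "inner_L2 f ?S = of_real (\<Sum>m\<le>n. (cmod (inner_L2 f (b m)))\<^sup>2)"
    by (subst inner_L2_commute) simp
  then have "0 \<le> sqnorm f - (\<Sum>m\<le>n. (cmod (inner_L2 f (b m)))\<^sup>2)"
    using sqnorm_diff[OF assms(2) S] orthonormal_sqnorm_sum[OF assms(1), of "{..n}" "\<lambda>m. inner_L2 f (b m)"]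
      sqnorm_nonneg[of "\<lambda>z. f z - ?S z"] by simp
  then show "(\<Sum>m\<le>n. (cmod (inner_L2 f (b m)))\<^sup>2) \<le> sqnorm f" by simp
qed auto

theorem Riesz_Fischer:
  assumes b: "orthonormal_L2 b" and s: "summable (\<lambda>m. (cmod (\<mu> m))\<^sup>2)"
  shows "\<exists>f. sums_L2 (\<lambda>m z. \<mu> m * b m z) f"
proof -
  have bL: "b m \<in> L2" for m using b by (auto simp: orthonormal_L2_def)
  define S where "S N z = (\<Sum>m<N. \<mu> m * b m z)" for N z
  have S: "S N \<in> L2" for N unfolding S_def by (intro L2_sum L2_scale bL)
  have diff: "sqnorm (\<lambda>z. S n z - S m z) = (\<Sum>i=m..<n. (cmod (\<mu> i))\<^sup>2)" if "m \<le> n" for m n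
  proof -
    have "(\<lambda>z. S n z - S m z) = (\<lambda>z. \<Sum>i=m..<n. \<mu> i * b i z)"
    proof
      fix z
      show "S n z - S m z = (\<Sum>i=m..<n. \<mu> i * b i z)"
        using that sum_diff_nat_ivl[of 0 m n "\<lambda>i. \<mu> i * b i z"] by (simp add: S_def atLeast0LessThan)
    qed
    then show ?thesis using orthonormal_sqnorm_sum[OF b] by simp
  qed
  have "\<exists>N. \<forall>m\<ge>N. \<forall>n\<ge>N. sqnorm (\<lambda>z. S m z - S n z) < e" if "e > 0" for e
  proof -
    obtain N where N: "\<And>m n. m \<ge> N \<Longrightarrow> norm (\<Sum>i=m..<n. (cmod (\<mu> i))\<^sup>2) < e"
      using s[unfolded summable_Cauchy, rule_format, OF \<open>e > 0\<close>] by auto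
    have "sqnorm (\<lambda>z. S m z - S n z) < e" if "m \<ge> N" "n \<ge> N" for m n
    proof (cases "m \<le> n")
      case True
      then show ?thesis using diff[of m n] N[of m n] that sqnorm_commute[of "S m" "S n"] by simp
    next
      case False
      then show ?thesis using diff[of n m] N[of n m] that by simp
    qed
    then show ?thesis by blast
  qed
  from L2_complete[OF S this] obtain f where 
    f: "f \<in> L2" "(\<lambda>n. sqnorm (\<lambda>z. f z - S n z)) \<longlonglongrightarrow> 0"
    by auto
  have "sums_L2 (\<lambda>m z. \<mu> m * b m z) f"
    unfolding sums_L2_sqnorm using f L2_scale[OF bL] unfolding S_def by simp
  then show ?thesis by (rule exI[of _ f])
qed

section \<open>Symmetries of the circle and Fourier coefficients\<close>

definition preserves_circle :: "(complex \<Rightarrow> complex) \<Rightarrow> bool" where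
  "preserves_circle T \<longleftrightarrow> T \<in> circle \<rightarrow>\<^sub>M circle \<and> distr circle circle T = circle"

text \<open>Moments determine a finite measure, so invariance of \<open>\<sigma>\<close> can be checked on them.\<close>
lemma preserves_circleI:
  assumes "T \<in> borel_measurable circle" "\<And>z. cmod z = 1 \<Longrightarrow> cmod (T z) = 1"
    and "\<And>n. n > 0 \<Longrightarrow> (LINT z|circle. T z ^ n) = 0"
  shows "preserves_circle T"
proof -
  have T: "T \<in> circle \<rightarrow>\<^sub>M circle"
    using assms(1,2) by (rule measurable_to_circle)
  have "distr circle circle T = circle"
  proof (rule finite_measure_circle_eqI)
    show "finite_measure (distr circle circle T)"
      using circle.prob_space_distr[OF T] prob_space_def by blast
    show "finite_measure circle" by unfold_locales
    fix n
    have "(LINT z|distr circle circle T. z ^ n) = (LINT z|circle. T z ^ n)"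
      by (rule integral_distr[OF T]) measurable
    also have "\<dots> = (LINT z|circle. z ^ n)"
      using assms(3)[of n] integral_circle_powi[of "int n"] by (cases "n = 0") auto
    finally show "(LINT z|distr circle circle T. z ^ n) = (LINT z|circle. z ^ n)" .
  qed auto
  with T show ?thesis by (simp add: preserves_circle_def)
qed

lemma
  assumes "preserves_circle T"
  shows preserves_circle_map: "T \<in> circle \<rightarrow>\<^sub>M circle"
    and preserves_circle_distr: "distr circle circle T = circle"
  using assms by (simp_all add: preserves_circle_def)

lemma preserves_circle_rotation:
  assumes "cmod lam = 1" shows "preserves_circle (\<lambda>z. lam * z)"
proof (rule preserves_circleI)
  fix n :: nat assume "n > 0"
  then show "(LINT z|circle. (lam * z) ^ n) = 0"
    using integral_circle_powi[of "int n"] by (simp add: power_mult_distrib)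
qed (use assms in \<open>auto simp: norm_mult\<close>)

lemma preserves_circle_cnj: "preserves_circle cnj"
proof (rule preserves_circleI)
  fix n :: nat assume "n > 0"
  have "(LINT z|circle. cnj z ^ n) = cnj (LINT z|circle. z ^ n)"
    by (subst Bochner_Integration.integral_cnj[symmetric]) simp
  then show "(LINT z|circle. cnj z ^ n) = 0"
    using integral_circle_powi[of "int n"] \<open>n > 0\<close> by simp
qed auto

lemma preserves_circle_reflection:
  assumes "cmod lam = 1" shows "preserves_circle (\<lambda>z. lam * cnj z)"
proof (rule preserves_circleI)
  fix n :: nat assume "n > 0"
  have "(LINT z|circle. (lam * cnj z) ^ n) = lam ^ n * cnj (LINT z|circle. z ^ n)"
    by (subst Bochner_Integration.integral_cnj[symmetric]) (simp add: power_mult_distrib)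
  then show "(LINT z|circle. (lam * cnj z) ^ n) = 0"
    using integral_circle_powi[of "int n"] \<open>n > 0\<close> by simp
qed (use assms in \<open>auto simp: norm_mult\<close>)

lemma preserves_circle_integral:
  fixes f :: "complex \<Rightarrow> 'b :: {banach, second_countable_topology}"
  assumes "preserves_circle T" "f \<in> borel_measurable circle"
  shows "(LINT z|circle. f (T z)) = (LINT z|circle. f z)"
  using integral_distr[OF preserves_circle_map[OF assms(1)] assms(2)]
  unfolding preserves_circle_distr[OF assms(1)] by simp

lemma preserves_circle_measurable:
  assumes "preserves_circle T" "f \<in> borel_measurable circle"
  shows "(\<lambda>z. f (T z)) \<in> borel_measurable circle"
  using preserves_circle_map[OF assms(1)] assms(2) by (rule measurable_compose)

lemma preserves_circle_L2:
  assumes "preserves_circle T" "f \<in> L2"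
  shows "(\<lambda>z. f (T z)) \<in> L2"
proof -
  have "integrable (distr circle circle T) (\<lambda>z. (cmod (f z))\<^sup>2)"
    unfolding preserves_circle_distr[OF assms(1)] by (rule L2_integrable_sq[OF assms(2)])
  then have "integrable circle (\<lambda>z. (cmod (f (T z)))\<^sup>2)"
    by (rule integrable_distr[OF preserves_circle_map[OF assms(1)]])
  then show ?thesis
    using preserves_circle_measurable[OF assms(1) L2_measurable[OF assms(2)]] by (simp add: L2_def)
qed

definition fourier_coeff :: "(complex \<Rightarrow> complex) \<Rightarrow> int \<Rightarrow> complex" where
  "fourier_coeff f k = inner_L2 f (\<lambda>z. z powi k)"

lemma continuous_on_circle_powi: "continuous_on (sphere 0 1) (\<lambda>z::complex. z powi k)"
  by (intro continuous_intros) auto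

lemma powi_L2: "(\<lambda>z. z powi k) \<in> L2"
  by (intro continuous_on_circle_L2 continuous_on_circle_powi)

lemma power_L2: "(\<lambda>z. z ^ n) \<in> L2"
  using powi_L2[of "int n"] by simp

lemma cnj_powi_circle: "cmod z = 1 \<Longrightarrow> cnj (z powi k) = z powi (- k)"
  by (simp add: cnj_eq_inverse_circle power_int_minus power_int_inverse)

lemma fourier_coeff_integral: "fourier_coeff f k = (LINT z|circle. f z * z powi (- k))"
  unfolding fourier_coeff_def inner_L2_def
  by (rule Bochner_Integration.integral_cong) (auto simp: cnj_powi_circle simp del: complex_cnj_power_int)

lemma fourier_coeff_powi: "fourier_coeff (\<lambda>z. z powi m) k = (if m = k then 1 else 0)"
proof -
  have "fourier_coeff (\<lambda>z. z powi m) k = (LINT z|circle. z powi (m - k))"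
    unfolding fourier_coeff_integral
  proof (rule Bochner_Integration.integral_cong)
    fix z assume "z \<in> space circle"
    then have "z \<noteq> 0" by auto
    then show "z powi m * z powi (- k) = z powi (m - k)"
      by (simp flip: power_int_add)
  qed simp
  then show ?thesis by (simp add: integral_circle_powi)
qed

lemma fourier_coeff_cong_AE:
  assumes "f \<in> L2" "g \<in> L2" "AE z in circle. f z = g z"
  shows "fourier_coeff f k = fourier_coeff g k"
  unfolding fourier_coeff_def using assms by (intro inner_L2_cong_AE L2_measurable powi_L2)

lemma fourier_coeff_add:
  "f \<in> L2 \<Longrightarrow> g \<in> L2 \<Longrightarrow> fourier_coeff (\<lambda>z. f z + g z) k = fourier_coeff f k + fourier_coeff g k"
  unfolding fourier_coeff_def by (intro inner_L2_add_left powi_L2)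

lemma fourier_coeff_diff:
  "f \<in> L2 \<Longrightarrow> g \<in> L2 \<Longrightarrow> fourier_coeff (\<lambda>z. f z - g z) k = fourier_coeff f k - fourier_coeff g k"
  unfolding fourier_coeff_def by (intro inner_L2_diff_left powi_L2)

lemma L2_eq_AE_iff_fourier_coeff:
  assumes "f \<in> L2" "g \<in> L2"
  shows "(AE z in circle. f z = g z) \<longleftrightarrow> (\<forall>k. fourier_coeff f k = fourier_coeff g k)"
proof
  assume *: "\<forall>k. fourier_coeff f k = fourier_coeff g k"
  have "AE z in circle. f z - g z = 0"
  proof (rule fourier_uniqueness)
    show "integrable circle (\<lambda>z. f z - g z)"
      by (intro L2_integrable L2_diff assms)
    show "(LINT z|circle. (f z - g z) * z powi k) = 0" for k
      using * fourier_coeff_diff[OF assms, of "- k"] fourier_coeff_integral[of "\<lambda>z. f z - g z" "- k"] by simp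
  qed
  then show "AE z in circle. f z = g z" by simp
qed (use assms fourier_coeff_cong_AE in blast)

lemma fourier_coeff_rotation:
  assumes "cmod lam = 1" "f \<in> L2"
  shows "fourier_coeff (\<lambda>z. f (lam * z)) k = lam powi k * fourier_coeff f k"
proof -
  have "fourier_coeff (\<lambda>z. f (lam * z)) k = 
      (LINT z|circle. lam powi k * (f (lam * z) * (lam * z) powi (- k)))"
    unfolding fourier_coeff_integral
    by (rule Bochner_Integration.integral_cong) (use assms in \<open>auto simp: power_int_mult_distrib power_int_minus field_simps\<close>)
  also have "\<dots> = lam powi k * (LINT z|circle. f (lam * z) * (lam * z) powi (- k))"
    by simp
  also have "(LINT z|circle. f (lam * z) * (lam * z) powi (- k)) = fourier_coeff f k"
    unfolding fourier_coeff_integral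
    by (rule preserves_circle_integral[OF preserves_circle_rotation[OF assms(1)]])
      (intro borel_measurable_times L2_measurable assms powi_L2)
  finally show ?thesis .
qed

text \<open>The substitution \<open>w = lam * cnj z\<close> is its own inverse.\<close>
lemma fourier_coeff_reflection:
  assumes "cmod lam = 1" "f \<in> L2"
  shows "fourier_coeff (\<lambda>z. f (lam * cnj z)) k = lam powi (- k) * fourier_coeff f (- k)"
proof -
  have "fourier_coeff (\<lambda>z. f (lam * cnj z)) k = 
      (LINT z|circle. lam powi (- k) * (f (lam * cnj z) * (lam * cnj z) powi k))"
    unfolding fourier_coeff_integral
  proof (rule Bochner_Integration.integral_cong)
    fix z assume "z \<in> space circle"
    then have "cnj z powi k = z powi (- k)"
      using cnj_powi_circle[of z k] by simp
    moreover have "lam \<noteq> 0"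
      using assms(1) by auto
    then have "lam powi (- k) * lam powi k = 1"
      by (simp add: power_int_minus)
    ultimately show "f (lam * cnj z) * z powi (- k) = lam powi (- k) * (f (lam * cnj z) * (lam * cnj z) powi k)"
      by (simp add: power_int_mult_distrib)
  qed simp
  also have "\<dots> = lam powi (- k) * (LINT z|circle. f (lam * cnj z) * (lam * cnj z) powi k)"
    by simp
  also have "(LINT z|circle. f (lam * cnj z) * (lam * cnj z) powi k) = fourier_coeff f (- k)"
    unfolding fourier_coeff_integral minus_minus
    by (rule preserves_circle_integral[OF preserves_circle_reflection[OF assms(1)]])
      (intro borel_measurable_times L2_measurable assms powi_L2)
  finally show ?thesis .
qed

lemma fourier_coeff_cnj: "fourier_coeff (\<lambda>z. cnj (f z)) k = cnj (fourier_coeff f (- k))"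
  unfolding fourier_coeff_integral Bochner_Integration.integral_cnj[symmetric]
  by (rule Bochner_Integration.integral_cong) (auto simp: cnj_powi_circle simp del: complex_cnj_power_int)

section \<open>Hardy space functions are those without negative Fourier coefficients\<close>

lemma orthonormal_monomials: "orthonormal_L2 (\<lambda>m z. z ^ m)"
  unfolding orthonormal_L2_def
proof (intro conjI allI)
  fix m n :: nat
  show "inner_L2 (\<lambda>z. z ^ m) (\<lambda>z. z ^ n) = (if m = n then 1 else 0)"
    using fourier_coeff_powi[of "int m" "int n"] by (simp add: fourier_coeff_def)
qed (rule power_L2)

lemma inner_monomial: "inner_L2 f (\<lambda>z. z ^ n) = fourier_coeff f (int n)"
  by (simp add: fourier_coeff_def)

lemma sums_L2_fourier_coeff:
  assumes "sums_L2 u f" "\<And>m. fourier_coeff (u m) k = 0"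
  shows "fourier_coeff f k = 0"
  using sums_L2_inner[OF assms(1) powi_L2, of k] assms(2) sums_unique2[OF sums_zero]
  by (simp add: fourier_coeff_def)

lemma analytic_series_exists:
  assumes "summable (\<lambda>n. (cmod (\<mu> n))\<^sup>2)"
  obtains f where "sums_L2 (\<lambda>n z. \<mu> n * z ^ n) f" "f \<in> L2"
    "\<And>k. k < 0 \<Longrightarrow> fourier_coeff f k = 0" "\<And>n. fourier_coeff f (int n) = \<mu> n"
proof -
  obtain f where f: "sums_L2 (\<lambda>n z. \<mu> n * z ^ n) f"
    using Riesz_Fischer[OF orthonormal_monomials assms] by blast
  show thesis
  proof (rule that[OF f])
    show "f \<in> L2" using f by (simp add: sums_L2_def)
    show "fourier_coeff f (int n) = \<mu> n" for n
      using orthonormal_sums_coeff[OF orthonormal_monomials f] by (simp add: inner_monomial)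
    show "fourier_coeff f k = 0" if "k < 0" for k
    proof (rule sums_L2_fourier_coeff[OF f])
      fix m
      show "fourier_coeff (\<lambda>z. \<mu> m * z ^ m) k = 0"
        using fourier_coeff_powi[of "int m" k] that
        by (simp add: fourier_coeff_def inner_L2_scale_left)
    qed
  qed
qed

lemma L2_bessel_monomials:
  "f \<in> L2 \<Longrightarrow> summable (\<lambda>n. (cmod (fourier_coeff f (int n)))\<^sup>2)"
  using orthonormal_Bessel[OF orthonormal_monomials] by (simp add: inner_monomial)

text \<open>The coefficients define an element of \<open>L\<^sup>2\<close> by the Riesz-Fischer theorem; it has the same
  Fourier coefficients as \<open>f\<close>, so it is \<open>f\<close> by uniqueness.\<close>
lemma analytic_L2_sums:
  assumes "f \<in> L2" "\<And>k. k < 0 \<Longrightarrow> fourier_coeff f k = 0"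
  shows "sums_L2 (\<lambda>n z. fourier_coeff f (int n) * z ^ n) f"
proof -
  obtain g where g: "sums_L2 (\<lambda>n z. fourier_coeff f (int n) * z ^ n) g" "g \<in> L2"
    "\<And>k. k < 0 \<Longrightarrow> fourier_coeff g k = 0" "\<And>n. fourier_coeff g (int n) = fourier_coeff f (int n)"
    using analytic_series_exists[OF L2_bessel_monomials[OF assms(1)]] by blast
  have "fourier_coeff g k = fourier_coeff f k" for k
    using g(3)[of k] g(4)[of "nat k"] assms(2)[of k] by (cases "k < 0") auto
  then have "AE z in circle. g z = f z"
    using L2_eq_AE_iff_fourier_coeff[OF g(2) assms(1)] by blast
  then show ?thesis
    by (rule sums_L2_cong_AE[OF g(1) assms(1)])
qed

lemma sums_L2_diff:
  assumes "sums_L2 u f" "sums_L2 v g"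
  shows "sums_L2 (\<lambda>n z. u n z - v n z) (\<lambda>z. f z - g z)"
proof -
  have L2: "f \<in> L2" "g \<in> L2" "\<And>n. u n \<in> L2" "\<And>n. v n \<in> L2"
    using assms by (auto simp: sums_L2_def)
  let ?a = "\<lambda>N z. f z - (\<Sum>m<N. u m z)" and ?b = "\<lambda>N z. g z - (\<Sum>m<N. v m z)"
  have ab: "?a N \<in> L2" "?b N \<in> L2" for N
    by (intro L2_diff L2_sum L2)+
  have "(\<lambda>N. 2 * sqnorm (?a N) + 2 * sqnorm (?b N)) \<longlonglongrightarrow> 2 * 0 + 2 * 0"
    using assms by (intro tendsto_intros) (auto simp: sums_L2_sqnorm)
  then have lim: "(\<lambda>N. 2 * sqnorm (?a N) + 2 * sqnorm (?b N)) \<longlonglongrightarrow> 0" by simp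
  have "(\<lambda>z. f z - g z - (\<Sum>m<N. u m z - v m z)) = (\<lambda>z. ?a N z - ?b N z)" for N
    by (simp add: sum_subtractf algebra_simps)
  moreover have "sqnorm (\<lambda>z. ?a N z - ?b N z) \<le> 2 * sqnorm (?a N) + 2 * sqnorm (?b N)" for N
    using sqnorm_triangle_diff[OF ab(1) L2_zero ab(2), of N N] sqnorm_commute[of "\<lambda>_. 0" "?b N"] by simp
  ultimately have "(\<lambda>N. sqnorm (\<lambda>z. f z - g z - (\<Sum>m<N. u m z - v m z))) \<longlonglongrightarrow> 0"
    by (intro Lim_null_comparison[OF _ lim]) auto
  then show ?thesis
    unfolding sums_L2_sqnorm using L2 by (auto intro: L2_diff)
qed

lemma uniform_sums_L2:
  assumes cont: "\<And>n. continuous_on (sphere 0 1) (u n)"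
    and le: "\<And>n z. cmod z = 1 \<Longrightarrow> cmod (u n z) \<le> M n" and M: "summable M"
  shows "sums_L2 u (\<lambda>z. \<Sum>n. u n z)"
proof -
  have unif: "uniform_limit (sphere 0 1) (\<lambda>N z. \<Sum>n<N. u n z) (\<lambda>z. \<Sum>n. u n z) sequentially"
    using le by (intro Weierstrass_m_test[OF _ M]) auto
  have "continuous_on (sphere 0 1) (\<lambda>z. \<Sum>n. u n z)"
    by (rule uniform_limit_theorem[OF _ unif])
      (intro always_eventually allI continuous_on_sum cont, simp)
  then have f: "(\<lambda>z. \<Sum>n. u n z) \<in> L2"
    by (rule continuous_on_circle_L2)
  have u: "u n \<in> L2" for n by (rule continuous_on_circle_L2[OF cont])
  have "(\<lambda>N. sqnorm (\<lambda>z. (\<Sum>n. u n z) - (\<Sum>n<N. u n z))) \<longlonglongrightarrow> 0"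
  proof (rule tendstoI)
    fix e :: real assume e: "e > 0"
    then have "\<forall>\<^sub>F N in sequentially. \<forall>z\<in>sphere 0 1. dist (\<Sum>n<N. u n z) (\<Sum>n. u n z) < sqrt (e / 2)"
      using uniform_limitD[OF unif, of "sqrt (e / 2)"] by simp
    then show "\<forall>\<^sub>F N in sequentially. dist (sqnorm (\<lambda>z. (\<Sum>n. u n z) - (\<Sum>n<N. u n z))) 0 < e"
    proof eventually_elim
      case (elim N)
      have "sqnorm (\<lambda>z. (\<Sum>n. u n z) - (\<Sum>n<N. u n z)) \<le> (LINT z|circle. e / 2)"
        unfolding sqnorm_def
      proof (rule integral_mono)
        show "integrable circle (\<lambda>z. (cmod ((\<Sum>n. u n z) - (\<Sum>n<N. u n z)))\<^sup>2)"
          by (intro L2_integrable_sq L2_diff L2_sum f u)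
        fix z assume "z \<in> space circle"
        then have "cmod ((\<Sum>n. u n z) - (\<Sum>n<N. u n z)) \<le> sqrt (e / 2)"
          using elim by (auto simp: dist_norm norm_minus_commute intro: less_imp_le)
        then show "(cmod ((\<Sum>n. u n z) - (\<Sum>n<N. u n z)))\<^sup>2 \<le> e / 2"
          using e power_mono[of "cmod ((\<Sum>n. u n z) - (\<Sum>n<N. u n z))" "sqrt (e / 2)" 2] by simp
      qed simp
      then show ?case using e by simp
    qed
  qed
  then show ?thesis unfolding sums_L2_sqnorm using f u by blast
qed

text \<open>For \<open>n > 0\<close> the function \<open>F (r z) * z ^ n\<close> is holomorphic and vanishes at 0, so its mean over the
  circle is 0; let \<open>r\<close> tend to 1.\<close>
lemma hardy_disk_boundary_coeff:
  assumes F: "F \<in> hardy_disk" and bf: "boundary_function F f" and k: "k < 0"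
  shows "fourier_coeff f k = 0"
proof -
  have hol: "F holomorphic_on ball 0 1" using F by (simp add: hardy_disk_def)
  have f: "f \<in> L2" and lim: "((\<lambda>r. sqnorm (\<lambda>z. F (of_real r * z) - f z)) \<longlongrightarrow> 0) (at_left 1)"
    using bf by (auto simp: boundary_function_def sqnorm_def)
  have ev: "\<forall>\<^sub>F r in at_left (1::real). 0 < r \<and> r < 1"
    using eventually_at_left_real[of 0 "1::real"] by simp
  have sub: "(\<lambda>z::complex. of_real r * z) ` cball 0 1 \<subseteq> ball 0 1" if "0 < r \<and> r < 1" for r :: real
  proof (rule image_subsetI)
    fix z :: complex assume "z \<in> cball 0 1"
    then have "r * cmod z \<le> r * 1" using that by (intro mult_left_mono) auto
    then have "r * cmod z < 1" using that by linarith
    then show "of_real r * z \<in> ball 0 1" using that by (simp add: norm_mult)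
  qed
  have cont: "continuous_on (cball 0 1) (\<lambda>z. F (of_real r * z))" if "0 < r \<and> r < 1" for r :: real
    by (rule continuous_on_compose2[OF holomorphic_on_imp_continuous_on[OF hol] _ sub[OF that]])
      (intro continuous_intros)
  have "\<forall>\<^sub>F r in at_left (1::real). (\<lambda>z. F (of_real r * z)) \<in> L2"
    using ev
  proof eventually_elim
    case (elim r)
    then show ?case
      by (intro continuous_on_circle_L2 continuous_on_subset[OF cont]) auto
  qed
  then have "((\<lambda>r. inner_L2 (\<lambda>z. F (of_real r * z)) (\<lambda>z. z powi k)) \<longlongrightarrow> inner_L2 f (\<lambda>z. z powi k)) (at_left 1)"
    using lim by (intro inner_L2_tendsto f powi_L2) (simp_all add: sqnorm_commute[of f])
  moreover have "\<forall>\<^sub>F r in at_left (1::real). inner_L2 (\<lambda>z. F (of_real r * z)) (\<lambda>z. z powi k) = 0"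
    using ev
  proof eventually_elim
    case (elim r)
    obtain n where n: "k = - int n" "n > 0"
      using k by (intro that[of "nat (- k)"]) auto
    have "inner_L2 (\<lambda>z. F (of_real r * z)) (\<lambda>z. z powi k) = (LINT z|circle. F (of_real r * z) * z ^ n)"
      using fourier_coeff_integral[of "\<lambda>z. F (of_real r * z)" k] n by (simp add: fourier_coeff_def)
    also have "\<dots> = F (of_real r * 0) * 0 ^ n"
    proof (rule integral_circle_mean_value)
      show "continuous_on (cball 0 1) (\<lambda>z. F (of_real r * z) * z ^ n)"
        by (intro continuous_intros cont elim)
      have "(F \<circ> (\<lambda>z. of_real r * z)) holomorphic_on ball 0 1"
      proof (rule holomorphic_on_compose_gen[OF _ hol])
        show "(\<lambda>z. of_real r * z) ` ball 0 1 \<subseteq> ball (0::complex) 1"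
          using image_mono[OF ball_subset_cball] sub[OF elim] by (rule subset_trans)
      qed (intro holomorphic_intros)
      then show "(\<lambda>z. F (of_real r * z) * z ^ n) holomorphic_on ball 0 1"
        by (intro holomorphic_intros) (simp add: o_def)
    qed
    finally show ?case using n by simp
  qed
  then have "((\<lambda>r. inner_L2 (\<lambda>z. F (of_real r * z)) (\<lambda>z. z powi k)) \<longlongrightarrow> 0) (at_left (1::real))"
    by (rule tendsto_eventually)
  ultimately show ?thesis
    unfolding fourier_coeff_def by (intro tendsto_unique[OF trivial_limit_at_left_real])
qed

text \<open>The power series \<open>F\<close> with the Fourier coefficients \<open>c n\<close> of \<open>f\<close> converges in the disk. Parseval's
  identity bounds its dilates by the norm of \<open>f\<close> and turns the squared distance between the dilate of
  radius \<open>r\<close> and \<open>f\<close> into the sum of \<open>\<bar>c n\<bar>\<^sup>2 * (1 - r ^ n)\<^sup>2\<close>, which tends to 0 by dominated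
  convergence (Tannery's theorem).\<close>
lemma analytic_L2_in_H2:
  assumes f: "f \<in> L2" and neg: "\<And>k. k < 0 \<Longrightarrow> fourier_coeff f k = 0"
  shows "f \<in> H2"
proof -
  define c where "c n = fourier_coeff f (int n)" for n
  have fs: "sums_L2 (\<lambda>n z. c n * z ^ n) f"
    unfolding c_def by (rule analytic_L2_sums[OF f neg])
  have sum2: "summable (\<lambda>n. (cmod (c n))\<^sup>2)"
    unfolding c_def by (rule L2_bessel_monomials[OF f])
  have bound: "cmod (c n) \<le> 1 + (\<Sum>n. (cmod (c n))\<^sup>2)" for n
  proof -
    have "(cmod (c n))\<^sup>2 \<le> (\<Sum>n. (cmod (c n))\<^sup>2)"
      using sum_le_suminf[OF sum2, of "{n}"] by simp
    moreover have "cmod (c n) \<le> 1 + (cmod (c n))\<^sup>2"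
      using sum_squares_bound[of "cmod (c n)" 1] norm_ge_zero[of "c n"]
      unfolding one_power2 mult_1_right by linarith
    ultimately show ?thesis by linarith
  qed
  define B where "B = 1 + (\<Sum>n. (cmod (c n))\<^sup>2)"
  define F where "F w = (\<Sum>n. c n * w ^ n)" for w
  have sumB: "summable (\<lambda>n. B * r ^ n)" if "0 \<le> r" "r < 1" for r :: real
    using that by (intro summable_mult summable_geometric) auto
  have le: "cmod (c n * w ^ n) \<le> B * cmod w ^ n" for n w
    using bound[of n] by (simp add: norm_mult norm_power B_def mult_right_mono)
  have hol: "F holomorphic_on ball 0 1"
  proof (rule power_series_holomorphic)
    fix w :: complex assume "w \<in> ball 0 1"
    then have "summable (\<lambda>n. c n * w ^ n)"
      using le by (intro summable_comparison_test'[OF sumB[of "cmod w"]]) auto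
    then show "(\<lambda>n. c n * (w - 0) ^ n) sums F w"
      unfolding F_def by (simp add: summable_sums)
  qed
  have Fr: "sums_L2 (\<lambda>n z. (c n * of_real r ^ n) * z ^ n) (\<lambda>z. F (of_real r * z))"
    if "0 \<le> r" "r < 1" for r :: real
  proof -
    have "sums_L2 (\<lambda>n z. (c n * of_real r ^ n) * z ^ n) (\<lambda>z. \<Sum>n. (c n * of_real r ^ n) * z ^ n)"
    proof (rule uniform_sums_L2[OF _ _ sumB[OF that]])
      show "cmod ((c n * of_real r ^ n) * z ^ n) \<le> B * r ^ n" if "cmod z = 1" for n z
        using le[of n "of_real r * z"] that \<open>0 \<le> r\<close> by (simp add: norm_mult power_mult_distrib mult.assoc)
    qed (intro continuous_intros)
    then show ?thesis
      unfolding F_def by (simp add: power_mult_distrib mult.assoc)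
  qed
  have "F \<in> hardy_disk"
    unfolding hardy_disk_def
  proof (intro CollectI conjI hol exI allI impI)
    fix r :: real assume r: "0 \<le> r \<and> r < 1"
    have P: "(\<lambda>n. (cmod (c n * of_real r ^ n))\<^sup>2) sums sqnorm (\<lambda>z. F (of_real r * z))"
      using r by (intro orthonormal_Parseval[OF orthonormal_monomials Fr]) auto
    have "sqnorm (\<lambda>z. F (of_real r * z)) \<le> (\<Sum>n. (cmod (c n))\<^sup>2)"
    proof (rule sums_le[OF _ P summable_sums[OF sum2]])
      fix n
      have "r ^ n \<le> 1" using r by (intro power_le_one) auto
      then show "(cmod (c n * of_real r ^ n))\<^sup>2 \<le> (cmod (c n))\<^sup>2"
        using r by (intro power_mono) (auto simp: norm_mult norm_power mult_left_le)
    qed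
    then show "(LINT z|circle. (cmod (F (of_real r * z)))\<^sup>2) \<le> (\<Sum>n. (cmod (c n))\<^sup>2)"
      by (simp add: sqnorm_def)
  qed
  moreover have "boundary_function F f"
    unfolding boundary_function_def
  proof (intro conjI f)
    have ev: "\<forall>\<^sub>F r in at_left (1::real). 0 < r \<and> r < 1"
      using eventually_at_left_real[of 0 "1::real"] by simp
    have P: "(\<lambda>n. (cmod (c n))\<^sup>2 * (1 - r ^ n)\<^sup>2) sums sqnorm (\<lambda>z. F (of_real r * z) - f z)"
      if "0 < r \<and> r < 1" for r :: real
    proof -
      have "sums_L2 (\<lambda>n z. (c n * (of_real r ^ n - 1)) * z ^ n) (\<lambda>z. F (of_real r * z) - f z)"
        using sums_L2_diff[OF Fr[of r] fs] that by (simp add: algebra_simps)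
      from orthonormal_Parseval[OF orthonormal_monomials this]
      have "(\<lambda>n. (cmod (c n * (of_real r ^ n - 1)))\<^sup>2) sums sqnorm (\<lambda>z. F (of_real r * z) - f z)" .
      moreover have "(cmod (c n * (of_real r ^ n - 1)))\<^sup>2 = (cmod (c n))\<^sup>2 * (1 - r ^ n)\<^sup>2" for n
      proof -
        have "cmod (of_real r ^ n - 1) = \<bar>r ^ n - 1\<bar>"
          using norm_of_real[of "r ^ n - 1", where 'a = complex] by simp
        then show ?thesis by (simp add: norm_mult power_mult_distrib power2_commute)
      qed
      ultimately show ?thesis by simp
    qed
    have "\<forall>\<^sub>F r in at_left (1::real). \<forall>n. norm ((cmod (c n))\<^sup>2 * (1 - r ^ n)\<^sup>2) \<le> (cmod (c n))\<^sup>2"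
      using ev
    proof eventually_elim
      case (elim r)
      have "(1 - r ^ n)\<^sup>2 \<le> 1" for n
        using elim by (intro power_le_one) (auto intro: power_le_one)
      then show ?case by (auto intro!: mult_left_le)
    qed
    then have "\<forall>\<^sub>F (k, r) in sequentially \<times>\<^sub>F at_left (1::real). 
        \<forall>n. norm ((cmod (c n))\<^sup>2 * (1 - r ^ n)\<^sup>2) \<le> (cmod (c n))\<^sup>2"
      by (subst eventually_prod2) auto
    then have bd: "\<forall>\<^sub>F (n, r) in sequentially \<times>\<^sub>F at_left (1::real). norm ((cmod (c n))\<^sup>2 * (1 - r ^ n)\<^sup>2) \<le> (cmod (c n))\<^sup>2"
      by (rule eventually_mono) auto
    have terms: "((\<lambda>r. (cmod (c n))\<^sup>2 * (1 - r ^ n)\<^sup>2) \<longlongrightarrow> (cmod (c n))\<^sup>2 * (1 - 1 ^ n)\<^sup>2) (at_left (1::real))" for n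
      by (intro tendsto_intros)
    have "((\<lambda>r. \<Sum>n. (cmod (c n))\<^sup>2 * (1 - r ^ n)\<^sup>2) \<longlongrightarrow> (\<Sum>n. (cmod (c n))\<^sup>2 * (1 - 1 ^ n)\<^sup>2)) (at_left (1::real))"
      using tannerys_theorem[OF terms bd sum2 trivial_limit_at_left_real] by blast
    then have "((\<lambda>r. \<Sum>n. (cmod (c n))\<^sup>2 * (1 - r ^ n)\<^sup>2) \<longlongrightarrow> 0) (at_left (1::real))"
      by simp
    moreover have "\<forall>\<^sub>F r in at_left (1::real). (\<Sum>n. (cmod (c n))\<^sup>2 * (1 - r ^ n)\<^sup>2) = 
        (LINT z|circle. (cmod (F (of_real r * z) - f z))\<^sup>2)"
      using ev
    proof eventually_elim
      case (elim r)
      then show ?case using P[OF elim] by (simp add: sums_iff sqnorm_def)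
    qed
    ultimately show "((\<lambda>r. LINT z|circle. (cmod (F (of_real r * z) - f z))\<^sup>2) \<longlongrightarrow> 0) (at_left 1)"
      by (rule Lim_transform_eventually)
  qed
  ultimately show ?thesis unfolding H2_def by blast
qed

text \<open>This trades the growth condition on dilates for linear conditions that are stable under limits in
  \<open>L\<^sup>2\<close>; the construction of the projection and the completeness of the bases rest on it.\<close>
theorem H2_iff_fourier_coeff:
  "f \<in> H2 \<longleftrightarrow> f \<in> L2 \<and> (\<forall>k<0. fourier_coeff f k = 0)"
proof
  assume "f \<in> H2"
  then obtain F where "F \<in> hardy_disk" "boundary_function F f"
    unfolding H2_def by blast
  then show "f \<in> L2 \<and> (\<forall>k<0. fourier_coeff f k = 0)"
    using hardy_disk_boundary_coeff[of F f] by (simp add: boundary_function_def)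
next
  assume "f \<in> L2 \<and> (\<forall>k<0. fourier_coeff f k = 0)"
  then show "f \<in> H2"
    by (intro analytic_L2_in_H2) auto
qed

lemma H2_L2: "f \<in> H2 \<Longrightarrow> f \<in> L2"
  by (simp add: H2_iff_fourier_coeff)

lemma H2_sums_L2:
  assumes "sums_L2 u f" "\<And>m. u m \<in> H2" shows "f \<in> H2"
  using assms sums_L2_fourier_coeff[OF assms(1)] by (simp add: H2_iff_fourier_coeff sums_L2_def)

lemma H2_scale: "f \<in> H2 \<Longrightarrow> (\<lambda>z. c * f z) \<in> H2"
  by (auto simp: H2_iff_fourier_coeff fourier_coeff_def inner_L2_scale_left intro: L2_scale)

lemma H2_taylor_sums: "f \<in> H2 \<Longrightarrow> sums_L2 (\<lambda>n z. fourier_coeff f (int n) * z ^ n) f"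
  by (intro analytic_L2_sums) (auto simp: H2_iff_fourier_coeff)

lemma holomorphic_H2:
  assumes "continuous_on (cball 0 1) f" "f holomorphic_on ball 0 1"
  shows "f \<in> H2"
  unfolding H2_iff_fourier_coeff
proof (intro conjI allI impI)
  show "f \<in> L2"
    by (intro continuous_on_circle_L2 continuous_on_subset[OF assms(1)]) auto
  fix k :: int assume "k < 0"
  then obtain n where n: "k = - int n" "n > 0"
    by (intro that[of "nat (- k)"]) auto
  have "fourier_coeff f k = (LINT z|circle. f z * z ^ n)"
    using fourier_coeff_integral[of f k] n by simp
  also have "\<dots> = f 0 * 0 ^ n"
    by (rule integral_circle_mean_value) (intro continuous_intros holomorphic_intros assms)+
  finally show "fourier_coeff f k = 0" using n by simp
qed

section \<open>Toeplitz operators and diagonal conjugations\<close>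

text \<open>The projection discards the Fourier coefficients of negative index.\<close>
lemma proj_H2_spec:
  assumes f: "f \<in> L2"
  shows "proj_H2 f \<in> H2 \<and> (\<forall>h\<in>H2. inner_L2 (\<lambda>z. f z - proj_H2 f z) h = 0)"
proof -
  obtain g where "sums_L2 (\<lambda>n z. fourier_coeff f (int n) * z ^ n) g"
    and g: "g \<in> L2" "\<And>k. k < 0 \<Longrightarrow> fourier_coeff g k = 0"
      "\<And>n. fourier_coeff g (int n) = fourier_coeff f (int n)"
    by (rule analytic_series_exists[OF L2_bessel_monomials[OF f]]) blast
  have gH: "g \<in> H2" using g by (simp add: H2_iff_fourier_coeff)
  have d: "(\<lambda>z. f z - g z) \<in> L2" by (intro L2_diff f g)
  have "inner_L2 (\<lambda>z. f z - g z) h = 0" if h: "h \<in> H2" for h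
  proof -
    have "inner_L2 (\<lambda>z. z ^ n) (\<lambda>z. f z - g z) = 0" for n
      using inner_monomial[of "\<lambda>z. f z - g z" n] fourier_coeff_diff[OF f g(1), of "int n"] g(3)[of n]
        inner_L2_commute[of "\<lambda>z. z ^ n" "\<lambda>z. f z - g z"] by simp
    then have "(\<lambda>n. 0) sums inner_L2 h (\<lambda>z. f z - g z)"
      using sums_L2_inner[OF H2_taylor_sums[OF h] d] by (simp add: inner_L2_scale_left)
    then have "inner_L2 h (\<lambda>z. f z - g z) = 0"
      using sums_unique2[OF sums_zero] by metis
    then show ?thesis by (subst inner_L2_commute) simp
  qed
  with gH have "\<exists>g. g \<in> H2 \<and> (\<forall>h\<in>H2. inner_L2 (\<lambda>z. f z - g z) h = 0)" by blast
  from someI_ex[OF this, folded proj_H2_def] show ?thesis .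
qed

lemma proj_H2_in_H2: "f \<in> L2 \<Longrightarrow> proj_H2 f \<in> H2"
  using proj_H2_spec by blast

lemma inner_proj_H2:
  assumes "f \<in> L2" "h \<in> H2" shows "inner_L2 (proj_H2 f) h = inner_L2 f h"
  using proj_H2_spec[OF assms(1)] assms
    inner_L2_diff_left[OF assms(1) H2_L2[OF proj_H2_in_H2[OF assms(1)]] H2_L2[OF assms(2)]]
  by simp

lemma toeplitz_in_H2: "\<phi> \<in> Linf \<Longrightarrow> f \<in> H2 \<Longrightarrow> toeplitz \<phi> f \<in> H2"
  unfolding toeplitz_def by (intro proj_H2_in_H2 L2_mult_Linf H2_L2)

lemma inner_toeplitz:
  "\<phi> \<in> Linf \<Longrightarrow> f \<in> H2 \<Longrightarrow> h \<in> H2 \<Longrightarrow> inner_L2 (toeplitz \<phi> f) h = inner_L2 (\<lambda>z. \<phi> z * f z) h"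
  unfolding toeplitz_def by (intro inner_proj_H2 L2_mult_Linf H2_L2)

lemma inner_L2_mult_left: "inner_L2 (\<lambda>z. \<phi> z * f z) g = inner_L2 f (\<lambda>z. cnj (\<phi> z) * g z)"
  unfolding inner_L2_def by (simp add: mult_ac)

text \<open>The adjoint exists because it is the Toeplitz operator of the conjugate symbol.\<close>
lemma adjoint_toeplitz_spec:
  assumes \<phi>: "\<phi> \<in> Linf" and g: "g \<in> H2"
  shows "adjoint_H2 (toeplitz \<phi>) g \<in> H2 \<and>
    (\<forall>f\<in>H2. inner_L2 (toeplitz \<phi> f) g = inner_L2 f (adjoint_H2 (toeplitz \<phi>) g))"
proof -
  let ?h = "toeplitz (\<lambda>z. cnj (\<phi> z)) g"
  have "inner_L2 (toeplitz \<phi> f) g = inner_L2 f ?h" if f: "f \<in> H2" for f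
  proof -
    have "inner_L2 f ?h = cnj (inner_L2 ?h f)"
      by (rule inner_L2_commute)
    also have "\<dots> = cnj (inner_L2 (\<lambda>z. cnj (\<phi> z) * g z) f)"
      by (simp add: inner_toeplitz[OF Linf_cnj[OF \<phi>] g f])
    also have "\<dots> = inner_L2 f (\<lambda>z. cnj (\<phi> z) * g z)"
      by (rule inner_L2_commute[symmetric])
    also have "\<dots> = inner_L2 (toeplitz \<phi> f) g"
      by (simp add: inner_toeplitz[OF \<phi> f g] inner_L2_mult_left)
    finally show ?thesis by simp
  qed
  then have "\<exists>h. h \<in> H2 \<and> (\<forall>f\<in>H2. inner_L2 (toeplitz \<phi> f) g = inner_L2 f h)"
    using toeplitz_in_H2[OF Linf_cnj[OF \<phi>] g] by blast
  from someI_ex[OF this, folded adjoint_H2_def] show ?thesis .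
qed

definition H2_basis :: "(nat \<Rightarrow> complex \<Rightarrow> complex) \<Rightarrow> bool" where
  "H2_basis b \<longleftrightarrow> orthonormal_L2 b \<and> (\<forall>m. b m \<in> H2) \<and>
     (\<forall>f\<in>H2. sums_L2 (\<lambda>m z. inner_L2 f (b m) * b m z) f)"

text \<open>If \<open>b\<close> is a basis, the coefficients of \<open>C f\<close> determine it up to a null set, so this says that \<open>C\<close> is the conjugation
  with \<open>C (b n) = \<alpha> n * b n\<close>, without choosing representatives.\<close>
definition diagonal_conj ::
    "((complex \<Rightarrow> complex) \<Rightarrow> complex \<Rightarrow> complex) \<Rightarrow> (nat \<Rightarrow> complex \<Rightarrow> complex) \<Rightarrow> (nat \<Rightarrow> complex) \<Rightarrow> bool" where
  "diagonal_conj C b \<alpha> \<longleftrightarrow>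
     (\<forall>f\<in>H2. C f \<in> H2 \<and> (\<forall>n. inner_L2 (C f) (b n) = \<alpha> n * cnj (inner_L2 f (b n))))"

lemma H2_basis_AE_eq_iff:
  assumes "H2_basis b" "f \<in> H2" "g \<in> H2"
  shows "(AE z in circle. f z = g z) \<longleftrightarrow> (\<forall>n. inner_L2 f (b n) = inner_L2 g (b n))"
proof
  assume "AE z in circle. f z = g z"
  then show "\<forall>n. inner_L2 f (b n) = inner_L2 g (b n)"
    using assms by (auto intro!: inner_L2_cong_AE L2_measurable H2_L2 simp: H2_basis_def)
next
  assume *: "\<forall>n. inner_L2 f (b n) = inner_L2 g (b n)"
  have "sums_L2 (\<lambda>m z. inner_L2 f (b m) * b m z) f" "sums_L2 (\<lambda>m z. inner_L2 f (b m) * b m z) g"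
    using assms * by (auto simp: H2_basis_def)
  then show "AE z in circle. f z = g z"
    by (rule sums_L2_unique_AE)
qed

text \<open>Comparing coefficients, \<open>C T C f = T\<^sup>* f\<close> says that
  \<open>\<langle>\<phi> * C f, b n\<rangle> * cnj (\<alpha> n) = \<langle>\<phi> * b n, f\<rangle>\<close> for all \<open>n\<close>; the projection and the adjoint
  disappear because one entry of each inner product lies in \<open>H\<^sup>2\<close>. Both sides are conjugate linear
  and continuous in \<open>f\<close>, so it is enough to test \<open>f = b m\<close>, where \<open>C (b m) = \<alpha> m * b m\<close>. The result
  is a condition on the matrix of the operator in the basis \<open>b\<close>.\<close>
theorem C_symmetric_toeplitz_iff:
  assumes b: "H2_basis b" and C: "diagonal_conj C b \<alpha>" and \<alpha>: "\<alpha> \<in> unimodular_seqs" and \<phi>: "\<phi> \<in> Linf"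
  shows "C_symmetric C (toeplitz \<phi>) \<longleftrightarrow>
    (\<forall>m n. \<alpha> m * cnj (\<alpha> n) * inner_L2 (\<lambda>z. \<phi> z * b m z) (b n) = inner_L2 (\<lambda>z. \<phi> z * b n z) (b m))"
proof -
  have bH: "b m \<in> H2" and orth: "inner_L2 (b m) (b n) = (if m = n then 1 else 0)" for m n
    using b by (auto simp: H2_basis_def orthonormal_L2_def)
  have unit: "cnj (\<alpha> n) * \<alpha> n = 1" for n
    using \<alpha> of_real_cmod_sq[of "\<alpha> n"] by (auto simp: unimodular_seqs_def mult.commute)
  have CH: "C f \<in> H2" and Cb: "inner_L2 (C f) (b n) = \<alpha> n * cnj (inner_L2 f (b n))"
    if "f \<in> H2" for f n
    using C that by (auto simp: diagonal_conj_def)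
  note \<phi>L2 = L2_mult_Linf[OF \<phi> H2_L2] L2_mult_Linf[OF Linf_cnj[OF \<phi>] H2_L2]

  have "C_symmetric C (toeplitz \<phi>) \<longleftrightarrow>
      (\<forall>f\<in>H2. \<forall>n. cnj (\<alpha> n) * inner_L2 (\<lambda>z. \<phi> z * C f z) (b n) = inner_L2 (\<lambda>z. \<phi> z * b n z) f)"
    unfolding C_symmetric_def
  proof (rule ball_cong[OF refl])
    fix f assume f: "f \<in> H2"
    let ?L = "C (toeplitz \<phi> (C f))" and ?R = "adjoint_H2 (toeplitz \<phi>) f"
    have TH: "toeplitz \<phi> (C f) \<in> H2" by (intro toeplitz_in_H2 \<phi> CH f)
    have L: "inner_L2 ?L (b n) = \<alpha> n * cnj (inner_L2 (\<lambda>z. \<phi> z * C f z) (b n))" for n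
      by (simp add: Cb[OF TH] inner_toeplitz[OF \<phi> CH[OF f] bH])
    have R: "inner_L2 ?R (b n) = cnj (inner_L2 (\<lambda>z. \<phi> z * b n z) f)" for n
      using adjoint_toeplitz_spec[OF \<phi> f] bH[of n] inner_toeplitz[OF \<phi> bH f, of n]
      by (subst inner_L2_commute) auto
    have "(AE z in circle. ?L z = ?R z) \<longleftrightarrow> (\<forall>n. inner_L2 ?L (b n) = inner_L2 ?R (b n))"
      using adjoint_toeplitz_spec[OF \<phi> f] by (intro H2_basis_AE_eq_iff b CH TH) blast
    also have "\<dots> \<longleftrightarrow> (\<forall>n. cnj (inner_L2 ?L (b n)) = cnj (inner_L2 ?R (b n)))"
      by (simp only: complex_cnj_cancel_iff)
    finally show "(AE z in circle. ?L z = ?R z) \<longleftrightarrow>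
        (\<forall>n. cnj (\<alpha> n) * inner_L2 (\<lambda>z. \<phi> z * C f z) (b n) = inner_L2 (\<lambda>z. \<phi> z * b n z) f)"
      by (simp add: L R)
  qed
  also have "\<dots> \<longleftrightarrow>
      (\<forall>m n. \<alpha> m * cnj (\<alpha> n) * inner_L2 (\<lambda>z. \<phi> z * b m z) (b n) = inner_L2 (\<lambda>z. \<phi> z * b n z) (b m))"
    (is "?F \<longleftrightarrow> ?M")
  proof
    assume F: ?F
    show ?M
    proof (intro allI)
      fix m n
      have "AE z in circle. C (b m) z = \<alpha> m * b m z"
        by (subst H2_basis_AE_eq_iff[OF b]) (auto intro: CH bH H2_scale simp: Cb[OF bH] orth inner_L2_scale_left)
      then have "AE z in circle. \<phi> z * C (b m) z = \<alpha> m * (\<phi> z * b m z)"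
        by eventually_elim simp
      then have "inner_L2 (\<lambda>z. \<phi> z * C (b m) z) (b n) = inner_L2 (\<lambda>z. \<alpha> m * (\<phi> z * b m z)) (b n)"
        by (intro inner_L2_cong_AE L2_measurable L2_scale \<phi>L2 CH bH H2_L2)
      then show "\<alpha> m * cnj (\<alpha> n) * inner_L2 (\<lambda>z. \<phi> z * b m z) (b n) = inner_L2 (\<lambda>z. \<phi> z * b n z) (b m)"
        using F[rule_format, OF bH, of n m] by (simp add: inner_L2_scale_left mult_ac)
    qed
  next
    assume M: ?M
    show ?F
    proof (intro ballI allI)
      fix f n assume f: "f \<in> H2"
      have "sums_L2 (\<lambda>m z. inner_L2 (C f) (b m) * b m z) (C f)"
        using b CH[OF f] by (auto simp: H2_basis_def)
      from sums_L2_inner[OF this \<phi>L2(2)[OF bH]]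
      have "(\<lambda>m. inner_L2 (C f) (b m) * inner_L2 (\<lambda>z. \<phi> z * b m z) (b n)) sums
          inner_L2 (\<lambda>z. \<phi> z * C f z) (b n)"
        by (simp add: inner_L2_scale_left inner_L2_mult_left)
      then have 1: "(\<lambda>m. cnj (\<alpha> n) * (inner_L2 (C f) (b m) * inner_L2 (\<lambda>z. \<phi> z * b m z) (b n))) sums
          (cnj (\<alpha> n) * inner_L2 (\<lambda>z. \<phi> z * C f z) (b n))"
        by (rule sums_mult)
      have "sums_L2 (\<lambda>m z. inner_L2 f (b m) * b m z) f"
        using b f by (auto simp: H2_basis_def)
      from sums_L2_inner[OF this \<phi>L2(1)[OF bH]]
      have "(\<lambda>m. inner_L2 f (b m) * inner_L2 (b m) (\<lambda>z. \<phi> z * b n z)) sums inner_L2 f (\<lambda>z. \<phi> z * b n z)"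
        by (simp add: inner_L2_scale_left)
      then have "(\<lambda>m. cnj (inner_L2 f (b m) * inner_L2 (b m) (\<lambda>z. \<phi> z * b n z))) sums
          cnj (inner_L2 f (\<lambda>z. \<phi> z * b n z))"
        by (simp only: sums_cnj)
      then have 2: "(\<lambda>m. cnj (inner_L2 f (b m)) * inner_L2 (\<lambda>z. \<phi> z * b n z) (b m)) sums
          inner_L2 (\<lambda>z. \<phi> z * b n z) f"
        unfolding complex_cnj_mult inner_L2_commute[symmetric] .
      have "cnj (\<alpha> n) * (inner_L2 (C f) (b m) * inner_L2 (\<lambda>z. \<phi> z * b m z) (b n)) =
          cnj (inner_L2 f (b m)) * inner_L2 (\<lambda>z. \<phi> z * b n z) (b m)" for m
        unfolding Cb[OF f] M[rule_format, of m n, symmetric] by (simp add: mult_ac)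
      with 1 have "(\<lambda>m. cnj (inner_L2 f (b m)) * inner_L2 (\<lambda>z. \<phi> z * b n z) (b m)) sums
          (cnj (\<alpha> n) * inner_L2 (\<lambda>z. \<phi> z * C f z) (b n))" by simp
      then show "cnj (\<alpha> n) * inner_L2 (\<lambda>z. \<phi> z * C f z) (b n) = inner_L2 (\<lambda>z. \<phi> z * b n z) f"
        using 2 by (rule sums_unique2)
    qed
  qed
  finally show ?thesis .
qed

lemma H2_basis_monomials: "H2_basis (\<lambda>m z. z ^ m)"
  unfolding H2_basis_def
proof (intro conjI allI ballI)
  show "orthonormal_L2 (\<lambda>m z. z ^ m)" by (rule orthonormal_monomials)
  show "(\<lambda>z. z ^ m) \<in> H2" for m
    by (intro holomorphic_H2 continuous_intros holomorphic_intros)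
  show "sums_L2 (\<lambda>m z. inner_L2 f (\<lambda>z. z ^ m) * z ^ m) f" if "f \<in> H2" for f
    using H2_taylor_sums[OF that] by (simp add: inner_monomial)
qed

lemma diagonal_conj_rot:
  assumes lam: "cmod lam = 1"
  shows "diagonal_conj (conj_rot lam) (\<lambda>m z. z ^ m) (\<lambda>m. cnj lam ^ m)"
  unfolding diagonal_conj_def
proof (intro ballI conjI allI)
  fix f assume f: "f \<in> H2"
  have rot: "conj_rot lam f = (\<lambda>z. cnj (f (lam * cnj z)))"
    by (simp add: fun_eq_iff conj_rot_def)
  have coeff: "fourier_coeff (conj_rot lam f) k = cnj (lam powi k) * cnj (fourier_coeff f k)" for k
    using fourier_coeff_reflection[OF lam H2_L2[OF f], of "- k"]
    by (simp add: rot fourier_coeff_cnj)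
  have "conj_rot lam f \<in> L2"
    unfolding rot by (intro L2_cnj preserves_circle_L2[OF preserves_circle_reflection[OF lam]] H2_L2 f)
  then show "conj_rot lam f \<in> H2"
    using f by (auto simp: H2_iff_fourier_coeff coeff)
  show "inner_L2 (conj_rot lam f) (\<lambda>z. z ^ n) = cnj lam ^ n * cnj (inner_L2 f (\<lambda>z. z ^ n))" for n
    by (simp add: inner_monomial coeff)
qed

text \<open>The defining description of the conjugation determines its value because the coefficients of a
  function in an orthonormal system are unique; a value exists because multiplication by \<open>\<alpha>\<close> and
  conjugation preserve square summability.\<close>
lemma diagonal_conj_seq:
  assumes b: "H2_basis (aut_basis a)" and \<alpha>: "\<alpha> \<in> unimodular_seqs"
  shows "diagonal_conj (conj_seq \<alpha> a) (aut_basis a) \<alpha>"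
  unfolding diagonal_conj_def
proof (intro ballI)
  fix f assume f: "f \<in> H2"
  have o: "orthonormal_L2 (aut_basis a)" and bH: "aut_basis a m \<in> H2" for m
    using b by (auto simp: H2_basis_def)
  let ?\<mu> = "\<lambda>m. inner_L2 f (aut_basis a m)"
  have fs: "sums_L2 (\<lambda>m z. ?\<mu> m * aut_basis a m z) f"
    using b f by (simp add: H2_basis_def)
  have "cmod (cnj (?\<mu> m) * \<alpha> m) = cmod (?\<mu> m)" for m
    using \<alpha> by (simp add: unimodular_seqs_def norm_mult)
  then have "summable (\<lambda>m. (cmod (cnj (?\<mu> m) * \<alpha> m))\<^sup>2)"
    using orthonormal_Bessel[OF o H2_L2[OF f]] by simp
  from Riesz_Fischer[OF o this]
  obtain g where g: "sums_L2 (\<lambda>m z. cnj (?\<mu> m) * \<alpha> m * aut_basis a m z) g"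
    by (rule exE)
  have "g \<in> H2"
    by (rule H2_sums_L2[OF g]) (intro H2_scale bH)
  then have "\<exists>g. g \<in> H2 \<and> (\<exists>\<mu>. sums_L2 (\<lambda>m z. \<mu> m * aut_basis a m z) f \<and>
          sums_L2 (\<lambda>m z. cnj (\<mu> m) * \<alpha> m * aut_basis a m z) g)"
    by (intro exI[of _ g] exI[of _ ?\<mu>] conjI fs g)
  from someI_ex[OF this, folded conj_seq_def]
  obtain \<mu> where C: "conj_seq \<alpha> a f \<in> H2" and \<mu>: "sums_L2 (\<lambda>m z. \<mu> m * aut_basis a m z) f"
    "sums_L2 (\<lambda>m z. cnj (\<mu> m) * \<alpha> m * aut_basis a m z) (conj_seq \<alpha> a f)"
    by blast
  from C show "conj_seq \<alpha> a f \<in> H2 \<and> 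
      (\<forall>n. inner_L2 (conj_seq \<alpha> a f) (aut_basis a n) = \<alpha> n * cnj (inner_L2 f (aut_basis a n)))"
    using orthonormal_sums_coeff[OF o \<mu>(1)] orthonormal_sums_coeff[OF o \<mu>(2)] by simp
qed

section \<open>Change of variables by a disk automorphism\<close>

lemma one_minus_cnj_mult_nonzero:
  assumes "cmod a < 1" "cmod z \<le> 1" shows "1 - cnj a * z \<noteq> 0"
proof
  assume "1 - cnj a * z = 0"
  then have "cmod (cnj a * z) = 1" by (metis eq_iff_diff_eq_0 norm_one)
  moreover have "cmod a * cmod z \<le> cmod a * 1" using assms by (intro mult_left_mono) auto
  ultimately show False using assms by (simp add: norm_mult)
qed

lemma disk_aut_norm_circle:
  assumes "cmod a < 1" "cmod z = 1" shows "cmod (disk_aut a z) = 1"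
proof -
  have "z * cnj (1 - cnj a * z) = z - a"
    using assms(2) of_real_cmod_sq[of z] by (simp add: algebra_simps)
  then have "cmod (z * cnj (1 - cnj a * z)) = cmod (z - a)"
    by (rule arg_cong)
  then have "cmod (1 - cnj a * z) = cmod (a - z)"
    using assms(2) unfolding norm_mult complex_mod_cnj by (simp add: norm_minus_commute)
  then show ?thesis
    using one_minus_cnj_mult_nonzero[of a z] assms by (auto simp: disk_aut_def norm_divide)
qed

text \<open>This identity makes \<open>e\<^sub>a \<circ> \<phi>\<^sub>a\<close> the reciprocal of \<open>e\<^sub>a\<close>, which is why the weighted composition
  operator below is an involution.\<close>
lemma one_minus_cnj_disk_aut:
  assumes "cmod a < 1" "cmod z = 1"
  shows "1 - cnj a * disk_aut a z = (1 - (cmod a)\<^sup>2) / (1 - cnj a * z)"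
proof -
  have "1 - cnj a * z \<noteq> 0" using assms by (intro one_minus_cnj_mult_nonzero) auto
  then show ?thesis
    by (simp add: disk_aut_def field_simps of_real_cmod_sq)
qed

lemma disk_aut_disk_aut:
  assumes "cmod a < 1" "cmod z = 1" shows "disk_aut a (disk_aut a z) = z"
proof -
  have nz: "1 - cnj a * z \<noteq> 0" using assms by (intro one_minus_cnj_mult_nonzero) auto
  have pos: "1 - (cmod a)\<^sup>2 > 0" using assms by (simp add: power_less_one_iff abs_square_less_1)
  then have nz2: "complex_of_real (1 - (cmod a)\<^sup>2) \<noteq> 0"
    by (simp only: of_real_eq_0_iff) 
  have "a - disk_aut a z = z * of_real (1 - (cmod a)\<^sup>2) / (1 - cnj a * z)"
    using nz by (simp add: disk_aut_def field_simps of_real_cmod_sq)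
  then have "disk_aut a (disk_aut a z) =
     (z * of_real (1 - (cmod a)\<^sup>2) / (1 - cnj a * z)) / (of_real (1 - (cmod a)\<^sup>2) / (1 - cnj a * z))"
    using one_minus_cnj_disk_aut[OF assms] by (subst disk_aut_def) (simp only:)
  also have "\<dots> = z"
    using nz nz2 by (simp only: field_simps) simp
  finally show ?thesis .
qed

lemma normalized_kernel_disk_aut:
  assumes "cmod a < 1" "cmod z = 1"
  shows "normalized_kernel a (disk_aut a z) * normalized_kernel a z = 1"
proof -
  have nz: "1 - cnj a * z \<noteq> 0" using assms by (intro one_minus_cnj_mult_nonzero) auto
  have pos: "1 - (cmod a)\<^sup>2 > 0" using assms by (simp add: power_less_one_iff abs_square_less_1)
  define s where "s = complex_of_real (sqrt (1 - (cmod a)\<^sup>2))"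
  have s: "s * s = of_real (1 - (cmod a)\<^sup>2)" "s \<noteq> 0"
    using pos unfolding s_def by (simp_all flip: of_real_mult)
  have "normalized_kernel a (disk_aut a z) * normalized_kernel a z = 
      s * (1 / (s * s / (1 - cnj a * z))) * (s * (1 / (1 - cnj a * z)))"
    unfolding normalized_kernel_def szego_kernel_def s(1) s_def[symmetric] one_minus_cnj_disk_aut[OF assms] ..
  also have "\<dots> = 1"
    using s(2) nz by (simp add: field_simps)
  finally show ?thesis .
qed

lemma
  assumes "cmod a < 1"
  shows continuous_on_disk_aut: "continuous_on (cball 0 1) (disk_aut a)"
    and continuous_on_normalized_kernel: "continuous_on (cball 0 1) (normalized_kernel a)"
    and holomorphic_disk_aut: "disk_aut a holomorphic_on ball 0 1"
    and holomorphic_normalized_kernel: "normalized_kernel a holomorphic_on ball 0 1"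
  unfolding disk_aut_def normalized_kernel_def szego_kernel_def
  using one_minus_cnj_mult_nonzero[OF assms]
  by (auto intro!: continuous_intros holomorphic_intros)

text \<open>The weight is the Poisson kernel. It is split into a function that is holomorphic in the disk
  and vanishes at 0 and a Cauchy kernel, the two shapes whose integrals against holomorphic functions
  are known.\<close>
lemma Poisson_kernel_eq:
  assumes "cmod a < 1" "cmod z = 1"
  shows "of_real ((cmod (normalized_kernel a z))\<^sup>2) = (1 / (1 - cnj a * z) - 1) + z / (z - a)"
proof -
  have nz: "1 - cnj a * z \<noteq> 0" using assms by (intro one_minus_cnj_mult_nonzero) auto
  have za: "z \<noteq> a" using assms by auto
  have z: "z * cnj z = 1" using assms(2) of_real_cmod_sq[of z] by simp
  have pos: "1 - (cmod a)\<^sup>2 > 0" using assms by (simp add: power_less_one_iff abs_square_less_1)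
  have "(cmod (normalized_kernel a z))\<^sup>2 = (1 - (cmod a)\<^sup>2) / (cmod (1 - cnj a * z))\<^sup>2"
    using pos by (simp add: normalized_kernel_def szego_kernel_def norm_mult norm_divide power_divide)
  then have "complex_of_real ((cmod (normalized_kernel a z))\<^sup>2) = (1 - a * cnj a) / ((1 - cnj a * z) * (1 - a * cnj z))"
    using of_real_cmod_sq[of "1 - cnj a * z"] of_real_cmod_sq[of a] by simp
  also have "1 - a * cnj z = (z - a) / z"
  proof -
    have "(1 - a * cnj z) * z = z - a"
      using z by (simp add: left_diff_distrib mult.assoc mult.commute[of "cnj z" z])
    moreover have "z \<noteq> 0" using assms(2) by auto
    ultimately show ?thesis by (simp add: nonzero_eq_divide_eq)
  qed
  also have "(1 - a * cnj a) / ((1 - cnj a * z) * ((z - a) / z)) = (1 / (1 - cnj a * z) - 1) + z / (z - a)"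
    using nz za assms(2) by (auto simp: divide_simps) (simp add: algebra_simps)
  finally show ?thesis .
qed

text \<open>The first part of the Poisson kernel contributes nothing, by the mean value property; the Cauchy kernel
  evaluates \<open>\<phi>\<^sub>a ^ n\<close> at \<open>a\<close>, where \<open>\<phi>\<^sub>a\<close> vanishes.\<close>
lemma integral_disk_aut_power:
  assumes a: "cmod a < 1"
  shows "(LINT z|circle. of_real ((cmod (normalized_kernel a z))\<^sup>2) * disk_aut a z ^ n) = (if n = 0 then 1 else 0)"
proof -
  let ?G = "\<lambda>z. (1 / (1 - cnj a * z) - 1) * disk_aut a z ^ n"
  have nz: "1 - cnj a * z \<noteq> 0" if "cmod z \<le> 1" for z
    using a that by (rule one_minus_cnj_mult_nonzero)
  have cD: "continuous_on (cball 0 1) (\<lambda>z. disk_aut a z ^ n)" 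
    by (intro continuous_intros continuous_on_disk_aut a)
  have hD: "(\<lambda>z. disk_aut a z ^ n) holomorphic_on ball 0 1"
    by (intro holomorphic_intros holomorphic_disk_aut a)
  have cG: "continuous_on (cball 0 1) ?G"
    by (intro continuous_intros continuous_on_disk_aut a) (use nz in auto)
  have hG: "?G holomorphic_on ball 0 1"
    by (intro holomorphic_intros holomorphic_disk_aut a) (use nz in auto)
  have cont2: "continuous_on (sphere 0 1) (\<lambda>z. disk_aut a z ^ n * z / (z - a))"
    using a by (intro continuous_intros continuous_on_subset[OF continuous_on_disk_aut[OF a]]) auto
  have "(LINT z|circle. of_real ((cmod (normalized_kernel a z))\<^sup>2) * disk_aut a z ^ n) =
      (LINT z|circle. ?G z + disk_aut a z ^ n * z / (z - a))"
  proof (rule Bochner_Integration.integral_cong)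
    fix z assume "z \<in> space circle"
    then have z: "cmod z = 1" by simp
    show "of_real ((cmod (normalized_kernel a z))\<^sup>2) * disk_aut a z ^ n =
        ?G z + disk_aut a z ^ n * z / (z - a)"
      unfolding Poisson_kernel_eq[OF a z] by (simp add: distrib_right)
  qed simp
  also have "\<dots> = (LINT z|circle. ?G z) + (LINT z|circle. disk_aut a z ^ n * z / (z - a))"
    by (intro Bochner_Integration.integral_add continuous_on_circle_integrable cont2
        continuous_on_subset[OF cG]) auto
  also have "(LINT z|circle. ?G z) = 0"
    using integral_circle_mean_value[OF cG hG] by simp
  also have "(LINT z|circle. disk_aut a z ^ n * z / (z - a)) = disk_aut a a ^ n"
    by (rule integral_circle_Cauchy[OF cD hD a])
  finally show ?thesis by (simp add: disk_aut_def)
qed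

lemma disk_aut_measurable:
  assumes a: "cmod a < 1" shows "disk_aut a \<in> circle \<rightarrow>\<^sub>M circle"
  using continuous_on_subset[OF continuous_on_disk_aut[OF a], of "sphere 0 1"]
  by (intro measurable_to_circle continuous_on_circle_measurable disk_aut_norm_circle a) auto

lemma normalized_kernel_continuous:
  assumes a: "cmod a < 1" shows "continuous_on (sphere 0 1) (normalized_kernel a)"
  by (rule continuous_on_subset[OF continuous_on_normalized_kernel[OF a]]) auto

text \<open>The change of variables \<open>w = \<phi>\<^sub>a z\<close>, obtained from the moments instead of a Jacobian.\<close>
theorem disk_aut_distr:
  assumes a: "cmod a < 1"
  shows "distr (density circle (\<lambda>z. ennreal ((cmod (normalized_kernel a z))\<^sup>2))) circle (disk_aut a) = circle"
proof (rule finite_measure_circle_eqI)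
  let ?w = "\<lambda>z. (cmod (normalized_kernel a z))\<^sup>2"
  let ?D = "density circle (\<lambda>z. ennreal (?w z))"
  have cw: "continuous_on (sphere 0 1) ?w"
    by (intro continuous_intros normalized_kernel_continuous a)
  have wm: "?w \<in> borel_measurable circle" by (rule continuous_on_circle_measurable[OF cw])
  have T: "disk_aut a \<in> ?D \<rightarrow>\<^sub>M circle" 
    using disk_aut_measurable[OF a] by simp
  have "finite_measure ?D"
  proof (rule finite_measureI)
    have "emeasure ?D (space ?D) = (\<integral>\<^sup>+z. ennreal (?w z) \<partial>circle)"
      unfolding space_density using wm by (subst emeasure_density) (auto intro!: nn_integral_cong simp del: space_circle)
    also have "\<dots> = ennreal (LINT z|circle. ?w z)"
      by (rule nn_integral_eq_integral[OF continuous_on_circle_integrable[OF cw]]) auto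
    finally show "emeasure ?D (space ?D) \<noteq> \<infinity>" by simp
  qed
  then show "finite_measure (distr ?D circle (disk_aut a))"
    using T by (rule finite_measure.finite_measure_distr)
  show "finite_measure circle" by unfold_locales
  fix n
  have "(LINT z|distr ?D circle (disk_aut a). z ^ n) = (LINT z|?D. disk_aut a z ^ n)"
    by (rule integral_distr[OF T]) measurable
  also have "\<dots> = (LINT z|circle. ?w z *\<^sub>R disk_aut a z ^ n)"
  proof (rule integral_density)
    show "(\<lambda>z. disk_aut a z ^ n) \<in> borel_measurable circle"
      using measurable_compose[OF disk_aut_measurable[OF a] id_measurable_circle] by measurable
  qed (use wm in auto)
  also have "\<dots> = (if n = 0 then 1 else 0)"
    using integral_disk_aut_power[OF a, of n] by (simp add: scaleR_conv_of_real)
  also have "\<dots> = (LINT z|circle. z ^ n)"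
    using integral_circle_powi[of "int n"] by simp
  finally show "(LINT z|distr ?D circle (disk_aut a). z ^ n) = (LINT z|circle. z ^ n)" .
qed auto

lemma disk_aut_compose_measurable:
  assumes "cmod a < 1" "f \<in> borel_measurable circle"
  shows "(\<lambda>z. f (disk_aut a z)) \<in> borel_measurable circle"
  using disk_aut_measurable[OF assms(1)] assms(2) by (rule measurable_compose)

text \<open>The density in the change of variables has no zeros on the circle, so \<open>\<phi>\<^sub>a\<close> pulls null sets back to
  null sets.\<close>
lemma disk_aut_AE:
  assumes a: "cmod a < 1" and P: "AE z in circle. P z"
  shows "AE z in circle. P (disk_aut a z)"
proof -
  let ?w = "\<lambda>z. (cmod (normalized_kernel a z))\<^sup>2"
  have wm: "?w \<in> borel_measurable circle"
    by (intro continuous_on_circle_measurable continuous_intros normalized_kernel_continuous a)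
  have T: "disk_aut a \<in> density circle (\<lambda>z. ennreal (?w z)) \<rightarrow>\<^sub>M circle" 
    using disk_aut_measurable[OF a] by simp
  have "AE z in density circle (\<lambda>z. ennreal (?w z)). P (disk_aut a z)"
    by (rule AE_distrD[OF T]) (use P in \<open>simp only: disk_aut_distr[OF a]\<close>)
  then have "AE z in circle. 0 < ennreal (?w z) \<longrightarrow> P (disk_aut a z)"
    using wm by (subst (asm) AE_density) auto
  moreover have "AE z in circle. cmod z = 1"
    using AE_space[of circle] by simp
  ultimately show ?thesis
  proof eventually_elim
    case (elim z)
    then have "normalized_kernel a z \<noteq> 0"
      using normalized_kernel_disk_aut[OF a] by force
    then show ?case using elim by simp
  qed
qed

lemma disk_aut_AE_iff:
  assumes a: "cmod a < 1"
  shows "(AE z in circle. P (disk_aut a z)) \<longleftrightarrow> (AE z in circle. P z)"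
proof
  assume "AE z in circle. P (disk_aut a z)"
  then have "AE z in circle. P (disk_aut a (disk_aut a z))"
    by (rule disk_aut_AE[OF a])
  then show "AE z in circle. P z"
    using AE_space[of circle] by eventually_elim (simp add: disk_aut_disk_aut[OF a])
qed (rule disk_aut_AE[OF a])

lemma disk_aut_Linf:
  assumes a: "cmod a < 1" and "\<phi> \<in> Linf" shows "(\<phi> \<circ> disk_aut a) \<in> Linf"
proof -
  obtain B where B: "AE z in circle. cmod (\<phi> z) \<le> B" and \<phi>: "\<phi> \<in> borel_measurable circle"
    using assms(2) by (auto simp: Linf_def)
  have "AE z in circle. cmod ((\<phi> \<circ> disk_aut a) z) \<le> B"
    using disk_aut_AE[OF a B] by simp
  moreover have "(\<phi> \<circ> disk_aut a) \<in> borel_measurable circle"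
    using disk_aut_compose_measurable[OF a \<phi>] by (simp add: o_def)
  ultimately show ?thesis
    unfolding Linf_def by blast
qed

section \<open>The basis attached to a point of the disk\<close>

text \<open>A unitary involution of \<open>L\<^sup>2\<close>: the squared modulus of the weight is the density in the change of
  variables, and composing the weight with \<open>\<phi>\<^sub>a\<close> gives its reciprocal. It carries the monomials to the
  basis attached to \<open>a\<close>.\<close>
definition aut_unitary :: "complex \<Rightarrow> (complex \<Rightarrow> complex) \<Rightarrow> complex \<Rightarrow> complex" where
  "aut_unitary a f z = f (disk_aut a z) * normalized_kernel a z"

lemma aut_unitary_integral:
  fixes f :: "complex \<Rightarrow> 'b :: {banach, second_countable_topology}"
  assumes a: "cmod a < 1" and f: "f \<in> borel_measurable circle"
  shows "(LINT z|circle. (cmod (normalized_kernel a z))\<^sup>2 *\<^sub>R f (disk_aut a z)) = (LINT z|circle. f z)"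
    and "integrable circle f \<Longrightarrow> integrable circle (\<lambda>z. (cmod (normalized_kernel a z))\<^sup>2 *\<^sub>R f (disk_aut a z))"
proof -
  let ?w = "\<lambda>z. (cmod (normalized_kernel a z))\<^sup>2"
  let ?D = "density circle (\<lambda>z. ennreal (?w z))"
  have wm: "?w \<in> borel_measurable circle"
    by (intro continuous_on_circle_measurable continuous_intros normalized_kernel_continuous a)
  have T: "disk_aut a \<in> ?D \<rightarrow>\<^sub>M circle" 
    using disk_aut_measurable[OF a] by simp
  note fm = disk_aut_compose_measurable[OF a f]
  have "(LINT z|circle. ?w z *\<^sub>R f (disk_aut a z)) = (LINT z|?D. f (disk_aut a z))"
    using fm wm by (intro integral_density[symmetric]) auto
  also have "\<dots> = (LINT z|distr ?D circle (disk_aut a). f z)"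
    by (rule integral_distr[OF T f, symmetric])
  finally show "(LINT z|circle. ?w z *\<^sub>R f (disk_aut a z)) = (LINT z|circle. f z)"
    unfolding disk_aut_distr[OF a] .
  assume "integrable circle f"
  then have "integrable (distr ?D circle (disk_aut a)) f"
    unfolding disk_aut_distr[OF a] .
  then have "integrable ?D (\<lambda>z. f (disk_aut a z))"
    by (rule integrable_distr[OF T])
  then show "integrable circle (\<lambda>z. ?w z *\<^sub>R f (disk_aut a z))"
    using fm wm by (subst (asm) integrable_density) auto
qed

lemma aut_unitary_L2:
  assumes a: "cmod a < 1" and f: "f \<in> L2" shows "aut_unitary a f \<in> L2"
proof -
  have sq: "(cmod (aut_unitary a f z))\<^sup>2 = (cmod (normalized_kernel a z))\<^sup>2 *\<^sub>R (cmod (f (disk_aut a z)))\<^sup>2" for z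
    by (simp add: aut_unitary_def norm_mult power_mult_distrib)
  have "integrable circle (\<lambda>z. (cmod (aut_unitary a f z))\<^sup>2)"
    unfolding sq using L2_integrable_sq[OF f] by (intro aut_unitary_integral(2)[OF a]) auto
  moreover have "aut_unitary a f \<in> borel_measurable circle"
    unfolding aut_unitary_def
    by (intro borel_measurable_times disk_aut_compose_measurable a L2_measurable f
        continuous_on_circle_measurable normalized_kernel_continuous)
  ultimately show ?thesis by (simp add: L2_def)
qed

lemma inner_aut_unitary:
  assumes a: "cmod a < 1" and f: "f \<in> L2" and g: "g \<in> L2"
  shows "inner_L2 (aut_unitary a f) (aut_unitary a g) = inner_L2 f g"
proof -
  have "inner_L2 (aut_unitary a f) (aut_unitary a g) = 
      (LINT z|circle. (cmod (normalized_kernel a z))\<^sup>2 *\<^sub>R (f (disk_aut a z) * cnj (g (disk_aut a z))))"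
    unfolding inner_L2_def aut_unitary_def
    by (rule Bochner_Integration.integral_cong) (simp_all add: scaleR_conv_of_real of_real_cmod_sq mult_ac)
  also have "\<dots> = inner_L2 f g"
    unfolding inner_L2_def 
    using L2_inner_integrable[OF f g] by (intro aut_unitary_integral(1)[OF a]) auto
  finally show ?thesis .
qed

lemma sqnorm_aut_unitary:
  assumes a: "cmod a < 1" and f: "f \<in> L2" shows "sqnorm (aut_unitary a f) = sqnorm f"
  using inner_aut_unitary[OF a f f] by (simp add: inner_L2_self)

lemma aut_unitary_involution:
  assumes a: "cmod a < 1" "cmod z = 1" shows "aut_unitary a (aut_unitary a f) z = f z"
  using normalized_kernel_disk_aut[OF assms] 
  by (simp add: aut_unitary_def disk_aut_disk_aut[OF assms] mult.assoc)

lemma sums_L2_aut_unitary: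
  assumes a: "cmod a < 1" and s: "sums_L2 u f"
  shows "sums_L2 (\<lambda>m. aut_unitary a (u m)) (aut_unitary a f)"
proof -
  have L2: "f \<in> L2" "u m \<in> L2" for m using s by (auto simp: sums_L2_def)
  have "(\<lambda>z. aut_unitary a f z - (\<Sum>m<N. aut_unitary a (u m) z)) =
      aut_unitary a (\<lambda>z. f z - (\<Sum>m<N. u m z))" for N
    by (simp add: aut_unitary_def fun_eq_iff left_diff_distrib sum_distrib_right)
  then have "sqnorm (\<lambda>z. aut_unitary a f z - (\<Sum>m<N. aut_unitary a (u m) z)) =
      sqnorm (\<lambda>z. f z - (\<Sum>m<N. u m z))" for N
    using sqnorm_aut_unitary[OF a L2_diff[OF L2(1) L2_sum[of "{..<N}" u]]] L2(2) by simp
  then show ?thesis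
    using s by (simp add: sums_L2_sqnorm aut_unitary_L2[OF a])
qed

lemma aut_unitary_monomial: "aut_unitary a (\<lambda>z. z ^ m) = aut_basis a m"
  by (simp add: fun_eq_iff aut_unitary_def aut_basis_def)

lemma aut_unitary_scale: "aut_unitary a (\<lambda>z. c * f z) = (\<lambda>z. c * aut_unitary a f z)"
  by (simp add: fun_eq_iff aut_unitary_def)

lemma aut_basis_H2:
  assumes a: "cmod a < 1" shows "aut_basis a m \<in> H2"
proof (rule holomorphic_H2)
  show "continuous_on (cball 0 1) (aut_basis a m)"
    unfolding aut_basis_def
    by (intro continuous_intros continuous_on_disk_aut continuous_on_normalized_kernel a)
  show "aut_basis a m holomorphic_on ball 0 1"
    unfolding aut_basis_def
    by (intro holomorphic_intros holomorphic_disk_aut holomorphic_normalized_kernel a)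
qed

lemma aut_unitary_H2:
  assumes a: "cmod a < 1" and f: "f \<in> H2" shows "aut_unitary a f \<in> H2"
proof (rule H2_sums_L2[OF sums_L2_aut_unitary[OF a H2_taylor_sums[OF f]]])
  show "aut_unitary a (\<lambda>z. fourier_coeff f (int m) * z ^ m) \<in> H2" for m
    unfolding aut_unitary_scale aut_unitary_monomial by (intro H2_scale aut_basis_H2 a)
qed

text \<open>The involution maps \<open>H\<^sup>2\<close> into itself, since it sends monomials to functions holomorphic across
  the circle; being an involution, it transports completeness of the monomials to this system.\<close>
theorem H2_basis_aut_basis:
  assumes a: "cmod a < 1" shows "H2_basis (aut_basis a)"
proof -
  have o: "orthonormal_L2 (aut_basis a)"
    using orthonormal_monomials unfolding orthonormal_L2_def
    by (auto simp: aut_unitary_L2[OF a] inner_aut_unitary[OF a] simp flip: aut_unitary_monomial)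
  have "sums_L2 (\<lambda>m z. inner_L2 f (aut_basis a m) * aut_basis a m z) f" if f: "f \<in> H2" for f
  proof -
    let ?g = "aut_unitary a f"
    let ?c = "\<lambda>m. fourier_coeff ?g (int m)"
    have "sums_L2 (\<lambda>m. aut_unitary a (\<lambda>z. ?c m * z ^ m)) (aut_unitary a ?g)"
      by (intro sums_L2_aut_unitary a H2_taylor_sums aut_unitary_H2 f)
    then have "sums_L2 (\<lambda>m z. ?c m * aut_basis a m z) (aut_unitary a ?g)"
      by (simp add: aut_unitary_scale aut_unitary_monomial)
    then have *: "sums_L2 (\<lambda>m z. ?c m * aut_basis a m z) f"
      by (rule sums_L2_cong_AE) (use f aut_unitary_involution[OF a] in \<open>auto intro: H2_L2\<close>)
    with orthonormal_sums_coeff[OF o *] show ?thesis by simp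
  qed
  with o aut_basis_H2[OF a] show ?thesis by (simp add: H2_basis_def)
qed

lemma inner_monomial_fourier_coeff:
  "inner_L2 (\<lambda>z. \<psi> z * z ^ m) (\<lambda>z. z ^ n) = fourier_coeff \<psi> (int n - int m)"
  unfolding fourier_coeff_integral inner_L2_def
proof (rule Bochner_Integration.integral_cong)
  fix z assume z: "z \<in> space circle"
  then have "z powi (- (int n - int m)) = z powi int m * z powi (- int n)"
    by (subst power_int_add[symmetric]) auto
  then show "\<psi> z * z ^ m * cnj (z ^ n) = \<psi> z * z powi (- (int n - int m))"
    using cnj_powi_circle[of z "int n"] z by simp
qed simp

text \<open>In the basis attached to \<open>a\<close> the operator with symbol \<open>\<phi>\<close> has the Toeplitz matrix of the symbol
  \<open>\<phi> \<circ> \<phi>\<^sub>a\<close>.\<close>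
lemma inner_aut_basis_fourier_coeff:
  assumes a: "cmod a < 1" and \<phi>: "\<phi> \<in> Linf"
  shows "inner_L2 (\<lambda>z. \<phi> z * aut_basis a m z) (aut_basis a n) = 
    fourier_coeff (\<phi> \<circ> disk_aut a) (int n - int m)"
proof -
  let ?\<psi> = "\<phi> \<circ> disk_aut a"
  have \<psi>: "(\<lambda>z. ?\<psi> z * z ^ m) \<in> L2"
    by (intro L2_mult_Linf disk_aut_Linf a \<phi> power_L2)
  have "inner_L2 (\<lambda>z. \<phi> z * aut_basis a m z) (aut_basis a n) =
      inner_L2 (aut_unitary a (\<lambda>z. ?\<psi> z * z ^ m)) (aut_unitary a (\<lambda>z. z ^ n))"
    unfolding inner_L2_def
    by (rule Bochner_Integration.integral_cong)
      (auto simp: aut_unitary_def aut_basis_def disk_aut_disk_aut[OF a])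
  also have "\<dots> = inner_L2 (\<lambda>z. ?\<psi> z * z ^ m) (\<lambda>z. z ^ n)"
    by (rule inner_aut_unitary[OF a \<psi> power_L2])
  also have "\<dots> = fourier_coeff ?\<psi> (int n - int m)"
    by (rule inner_monomial_fourier_coeff)
  finally show ?thesis .
qed

section \<open>The symmetry condition on Fourier coefficients\<close>

text \<open>For the Fourier coefficients \<open>c\<close> of \<open>\<phi> \<circ> \<phi>\<^sub>a\<close> this is the common content of all five
  conditions.\<close>
definition coeff_symmetric :: "complex \<Rightarrow> (int \<Rightarrow> complex) \<Rightarrow> bool" where
  "coeff_symmetric lam c \<longleftrightarrow> (\<forall>k. c (- k) = lam powi k * c k)"

lemma coeff_symmetric_natI:
  assumes "lam \<noteq> 0" "\<And>k::nat. c (- int k) = lam ^ k * c (int k)"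
  shows "coeff_symmetric lam c"
  unfolding coeff_symmetric_def
proof
  fix k :: int
  show "c (- k) = lam powi k * c k"
  proof (cases "k \<ge> 0")
    case True
    then show ?thesis using assms(2)[of "nat k"] by (simp add: power_int_def)
  next
    case False
    then have "c k = lam ^ nat (- k) * c (- k)"
      using assms(2)[of "nat (- k)"] by simp
    moreover have "lam powi k = inverse (lam ^ nat (- k))"
      using False by (simp add: power_int_def power_inverse)
    ultimately show ?thesis using assms(1) by simp
  qed
qed

text \<open>For \<open>\<alpha> m = cnj lam ^ m\<close> the phase \<open>\<alpha> m * cnj (\<alpha> n)\<close> depends only on \<open>n - m\<close>, and every integer is
  such a difference.\<close>
lemma coeff_symmetric_powers_iff:
  assumes lam: "cmod lam = 1"
  shows "(\<forall>m n. cnj lam ^ m * cnj (cnj lam ^ n) * c (int n - int m) = c (int m - int n)) \<longleftrightarrow>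
    coeff_symmetric lam c"
proof -
  have nz: "lam \<noteq> 0" using lam by auto
  have pw: "cnj lam ^ m * cnj (cnj lam ^ n) = lam powi (int n - int m)" for m n
    using nz by (simp add: power_int_diff cnj_eq_inverse_circle[OF lam] power_inverse field_simps)
  show ?thesis
    unfolding pw coeff_symmetric_def
  proof (intro iffI allI)
    fix k
    assume *: "\<forall>m n. lam powi (int n - int m) * c (int n - int m) = c (int m - int n)"
    show "c (- k) = lam powi k * c k"
      using *[rule_format, of "nat k" "nat (- k)"] by (cases "k \<ge> 0") auto
  next
    fix m n :: nat
    assume *: "\<forall>k. c (- k) = lam powi k * c k"
    show "lam powi (int n - int m) * c (int n - int m) = c (int m - int n)"
      using *[rule_format, of "int n - int m"] by simp
  qed
qed

lemma exists_unimodular_root: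
  assumes "cmod w = 1" "d > 0" shows "\<exists>lam. cmod lam = 1 \<and> lam ^ d = w"
proof -
  obtain t where "w = cis t"
    using assms(1) complex_norm_eq_1_exp by (metis cis_conv_exp)
  moreover have "real d * (t / real d) = t"
    using assms(2) by simp
  ultimately have "cis (t / real d) ^ d = w"
    by (simp only: Complex.DeMoivre)
  then show ?thesis by (intro exI[of _ "cis (t / real d)"]) simp
qed

text \<open>Whenever \<open>c k\<close> is nonzero, the hypothesis says that a shift by \<open>k\<close> multiplies \<open>\<alpha>\<close> by a constant.
  The shifts with this property are the multiples of the least positive one, \<open>d\<close>, by division with
  remainder, and the constant for \<open>j * d\<close> is the \<open>j\<close>-th power of the constant \<open>u\<close> for \<open>d\<close>. Hence any
  \<open>d\<close>-th root of \<open>cnj u\<close> reproduces the phases that \<open>\<alpha>\<close> gives to the nonzero coefficients, although \<open>\<alpha>\<close>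
  itself may be far from a geometric sequence.\<close>
lemma diagonal_unitary_to_character:
  assumes \<alpha>: "\<alpha> \<in> unimodular_seqs"
    and c: "\<And>m n. \<alpha> m * cnj (\<alpha> n) * c (int n - int m) = c (int m - int n)"
  shows "\<exists>lam. cmod lam = 1 \<and> coeff_symmetric lam c"
proof -
  have unit: "cmod (\<alpha> n) = 1" for n using \<alpha> by (simp add: unimodular_seqs_def)
  then have nz: "\<alpha> n \<noteq> 0" for n by (metis norm_zero zero_neq_one)
  define S where "S = {k::nat. \<exists>w. \<forall>m. \<alpha> (m + k) = w * \<alpha> m}"
  have period: "c (- int k) = 0 \<and> c (int k) = 0 \<or>
      (\<exists>w. (\<forall>m. \<alpha> (m + k) = w * \<alpha> m) \<and> c (- int k) = cnj w * c (int k))" for k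
  proof (cases "c (int k) = 0")
    case True
    then show ?thesis using c[of 0 k] by simp
  next
    case False
    define v where "v = c (- int k) / c (int k)"
    have "\<alpha> (m + k) = cnj v * \<alpha> m" for m
    proof -
      have "\<alpha> m * cnj (\<alpha> (m + k)) = v"
        using c[of m "m + k"] False by (simp add: v_def field_simps)
      then have "cnj v * \<alpha> m = \<alpha> (m + k) * (\<alpha> m * cnj (\<alpha> m))"
        by (auto simp: mult_ac)
      also have "\<alpha> m * cnj (\<alpha> m) = 1"
        using unit[of m] of_real_cmod_sq[of "\<alpha> m"] by simp
      finally show ?thesis by simp
    qed
    moreover have "c (- int k) = cnj (cnj v) * c (int k)"
      using False by (simp add: v_def)
    ultimately show ?thesis by blast
  qed
  show ?thesis
  proof (cases "\<exists>d>0. d \<in> S")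
    case False
    \<comment> \<open>Then \<open>c k = 0\<close> for all nonzero \<open>k\<close>, and any unimodular number will do.\<close>
    have "coeff_symmetric 1 c"
    proof (rule coeff_symmetric_natI)
      fix k :: nat
      show "c (- int k) = 1 ^ k * c (int k)"
      proof (cases "k = 0")
        case nonzero: False
        then have "k \<notin> S" using False by blast
        then have "c (- int k) = 0 \<and> c (int k) = 0"
          using period[of k] unfolding S_def by blast
        then show ?thesis by simp
      qed simp
    qed simp
    then show ?thesis by (intro exI[of _ 1]) simp
  next
    case True
    define d where "d = (LEAST d. d > 0 \<and> d \<in> S)"
    have "d > 0 \<and> d \<in> S"
      unfolding d_def by (rule LeastI_ex) (use True in blast)
    then have d: "d > 0" and "d \<in> S" by auto
    have least: "r = 0" if "r < d" "r \<in> S" for r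
      using that not_less_Least[of r "\<lambda>d. d > 0 \<and> d \<in> S"] unfolding d_def by auto
    obtain u where u: "\<And>m. \<alpha> (m + d) = u * \<alpha> m"
      using \<open>d \<in> S\<close> unfolding S_def by blast
    have u1: "cmod u = 1"
      using u[of 0] unit[of d] unit[of 0] by (simp add: norm_mult)
    then have u0: "u \<noteq> 0" by auto
    have upow: "\<alpha> (m + j * d) = u ^ j * \<alpha> m" for m j
    proof (induction j)
      case (Suc j)
      have "\<alpha> (m + Suc j * d) = \<alpha> ((m + j * d) + d)" by (simp add: algebra_simps)
      then show ?case using Suc by (simp add: u)
    qed simp
    obtain lam where lam: "cmod lam = 1" "lam ^ d = cnj u"
      using exists_unimodular_root[of "cnj u" d] u1 d by auto
    have "coeff_symmetric lam c"
    proof (rule coeff_symmetric_natI)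
      show "lam \<noteq> 0" using lam(1) by auto
      fix k :: nat
      show "c (- int k) = lam ^ k * c (int k)"
        using period[of k]
      proof
        assume "\<exists>w. (\<forall>m. \<alpha> (m + k) = w * \<alpha> m) \<and> c (- int k) = cnj w * c (int k)"
        then obtain w where w: "\<And>m. \<alpha> (m + k) = w * \<alpha> m" and ck: "c (- int k) = cnj w * c (int k)"
          by blast
        define j where "j = k div d"
        have k: "k = k mod d + j * d" by (simp add: j_def)
        have "\<alpha> (m + k mod d) = (w / u ^ j) * \<alpha> m" for m
        proof -
          have "u ^ j * \<alpha> (m + k mod d) = \<alpha> (m + k)"
            using upow[of "m + k mod d" j] k by (simp add: add.assoc)
          then show ?thesis using u0 w[of m] by (simp add: field_simps)
        qed
        \<comment> \<open>Minimality of \<open>d\<close> rules out a positive remainder.\<close>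
        then have "k mod d \<in> S" unfolding S_def by blast
        then have "k mod d = 0" using least[of "k mod d"] d by simp
        then have kj: "k = j * d" using k by simp
        have "w = u ^ j"
          using w[of 0] upow[of 0 j] nz[of 0] kj by simp
        then have "cnj w = lam ^ k"
          by (simp add: kj lam(2)[symmetric] power_mult[symmetric] mult.commute)
        then show ?thesis using ck by simp
      qed auto
    qed
    with lam(1) show ?thesis by blast
  qed
qed

lemma reflection_symmetric_iff:
  assumes \<psi>: "\<psi> \<in> L2" and lam: "cmod lam = 1"
  shows "(AE z in circle. \<psi> (lam * z) = \<psi> (cnj z)) \<longleftrightarrow> coeff_symmetric lam (fourier_coeff \<psi>)"
proof -
  have "fourier_coeff (\<lambda>z. \<psi> (cnj z)) k = fourier_coeff \<psi> (- k)" for k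
    using fourier_coeff_reflection[of 1 \<psi> k] \<psi> by simp
  then show ?thesis
    using L2_eq_AE_iff_fourier_coeff[OF preserves_circle_L2[OF preserves_circle_rotation[OF lam] \<psi>]
        preserves_circle_L2[OF preserves_circle_cnj \<psi>]]
    by (auto simp: coeff_symmetric_def fourier_coeff_rotation[OF lam \<psi>])
qed

text \<open>The coefficient of \<open>f + f (lam * cnj z)\<close> at \<open>k\<close> is \<open>c k + lam ^ (- k) * c (- k)\<close> with \<open>c\<close> the
  coefficients of \<open>f\<close>. For \<open>f\<close> in \<open>H\<^sup>2\<close> at most one of the two terms is nonzero unless \<open>k = 0\<close>, where both
  are equal; so \<open>f\<close> must carry the positive coefficients of \<open>\<psi>\<close> and half of its mean.\<close>
lemma analytic_decomposition_iff:
  assumes \<psi>: "\<psi> \<in> L2" and lam: "cmod lam = 1"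
  shows "(\<exists>f\<in>H2. AE z in circle. \<psi> z = f z + f (lam * cnj z)) \<longleftrightarrow> 
    coeff_symmetric lam (fourier_coeff \<psi>)"
proof -
  have nz: "lam \<noteq> 0" using lam by auto
  have L2: "(\<lambda>z. f (lam * cnj z)) \<in> L2" if "f \<in> L2" for f
    by (rule preserves_circle_L2[OF preserves_circle_reflection[OF lam] that])
  have coeff: "fourier_coeff (\<lambda>z. f z + f (lam * cnj z)) k =
      fourier_coeff f k + lam powi (- k) * fourier_coeff f (- k)" if "f \<in> L2" for f k
    using that by (simp add: fourier_coeff_add L2 fourier_coeff_reflection[OF lam])
  show ?thesis
  proof
    assume "\<exists>f\<in>H2. AE z in circle. \<psi> z = f z + f (lam * cnj z)"
    then obtain f where f: "f \<in> L2" and AE: "AE z in circle. \<psi> z = f z + f (lam * cnj z)"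
      using H2_L2 by blast
    have "fourier_coeff \<psi> k = fourier_coeff f k + lam powi (- k) * fourier_coeff f (- k)" for k
      using fourier_coeff_cong_AE[OF \<psi> L2_add[OF f L2[OF f]] AE] coeff[OF f] by simp
    note eq = this
    show "coeff_symmetric lam (fourier_coeff \<psi>)"
      unfolding coeff_symmetric_def
    proof
      fix k
      show "fourier_coeff \<psi> (- k) = lam powi k * fourier_coeff \<psi> k"
        using nz by (simp add: eq[of k] eq[of "- k"] power_int_minus field_simps)
    qed
  next
    assume E: "coeff_symmetric lam (fourier_coeff \<psi>)"
    \<comment> \<open>The constant term enters once through \<open>f\<close> and once through its reflection, hence the factor 1/2.\<close>
    define \<mu> where "\<mu> n = (if n = 0 then fourier_coeff \<psi> 0 / 2 else fourier_coeff \<psi> (int n))" for n :: nat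
    have "summable (\<lambda>n. (cmod (\<mu> n))\<^sup>2)"
    proof (rule summable_comparison_test'[OF L2_bessel_monomials[OF \<psi>]])
      show "norm ((cmod (\<mu> n))\<^sup>2) \<le> (cmod (fourier_coeff \<psi> (int n)))\<^sup>2" for n
        by (simp add: \<mu>_def norm_divide power_divide)
    qed
    then obtain f where "sums_L2 (\<lambda>n z. \<mu> n * z ^ n) f" and f: "f \<in> L2"
      and neg: "\<And>k. k < 0 \<Longrightarrow> fourier_coeff f k = 0" and pos: "\<And>n. fourier_coeff f (int n) = \<mu> n"
      by (rule analytic_series_exists) blast
    have "fourier_coeff \<psi> k = fourier_coeff (\<lambda>z. f z + f (lam * cnj z)) k" for k
    proof (cases k "0 :: int" rule: linorder_cases)
      case less
      then have "fourier_coeff f (- k) = fourier_coeff \<psi> (- k)"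
        using pos[of "nat (- k)"] by (simp add: \<mu>_def)
      then show ?thesis
        using less neg[of k] E[unfolded coeff_symmetric_def, rule_format, of "- k"] by (simp add: coeff[OF f])
    next
      case equal
      then show ?thesis using pos[of 0] by (simp add: coeff[OF f] \<mu>_def field_simps)
    next
      case greater
      then show ?thesis
        using neg[of "- k"] pos[of "nat k"] by (simp add: coeff[OF f] \<mu>_def)
    qed
    then have "AE z in circle. \<psi> z = f z + f (lam * cnj z)"
      using L2_eq_AE_iff_fourier_coeff[OF \<psi> L2_add[OF f L2[OF f]]] by blast
    moreover have "f \<in> H2" using f neg by (simp add: H2_iff_fourier_coeff)
    ultimately show "\<exists>f\<in>H2. AE z in circle. \<psi> z = f z + f (lam * cnj z)" by blast
  qed
qed

section \<open>Equivalence of the five conditions\<close>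

theorem corollary2p5:
  fixes \<phi> :: "complex \<Rightarrow> complex" and a :: complex
  assumes "\<phi> \<in> Linf" and "a \<in> ball 0 1"
  shows
    "((\<exists>\<alpha>\<in>unimodular_seqs. C_symmetric (conj_seq \<alpha> a) (toeplitz \<phi>)) \<longleftrightarrow>
      (\<exists>lam\<in>sphere 0 1. C_symmetric (conj_rot_at lam a) (toeplitz \<phi>))) \<and>
     ((\<exists>lam\<in>sphere 0 1. C_symmetric (conj_rot_at lam a) (toeplitz \<phi>)) \<longleftrightarrow>
      (\<exists>lam\<in>sphere 0 1. C_symmetric (conj_rot lam) (toeplitz (\<phi> \<circ> disk_aut a)))) \<and>
     ((\<exists>lam\<in>sphere 0 1. C_symmetric (conj_rot lam) (toeplitz (\<phi> \<circ> disk_aut a))) \<longleftrightarrow>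
      (\<exists>lam\<in>sphere 0 1. \<exists>f\<in>H2. AE z in circle.
         \<phi> z = (f \<circ> disk_aut a) z + cnj ((conj_rot lam f \<circ> disk_aut a) z))) \<and>
     ((\<exists>lam\<in>sphere 0 1. \<exists>f\<in>H2. AE z in circle.
         \<phi> z = (f \<circ> disk_aut a) z + cnj ((conj_rot lam f \<circ> disk_aut a) z)) \<longleftrightarrow>
      (\<exists>lam\<in>sphere 0 1. AE z in circle.
         (\<phi> \<circ> disk_aut a) (lam * z) = (\<phi> \<circ> disk_aut a) (cnj z)))"
proof -
  note \<phi> = assms(1)
  have a: "cmod a < 1" using assms(2) by simp
  define \<psi> where "\<psi> = \<phi> \<circ> disk_aut a"
  let ?c = "fourier_coeff \<psi>"
  have \<psi>: "\<psi> \<in> Linf" unfolding \<psi>_def by (rule disk_aut_Linf[OF a \<phi>])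
  have powers: "(\<lambda>m. cnj lam ^ m) \<in> unimodular_seqs" if "cmod lam = 1" for lam
    using that by (simp add: unimodular_seqs_def norm_power)

  have A: "C_symmetric (conj_seq \<alpha> a) (toeplitz \<phi>) \<longleftrightarrow>
      (\<forall>m n. \<alpha> m * cnj (\<alpha> n) * ?c (int n - int m) = ?c (int m - int n))"
    if "\<alpha> \<in> unimodular_seqs" for \<alpha>
    using C_symmetric_toeplitz_iff[OF H2_basis_aut_basis[OF a] 
        diagonal_conj_seq[OF H2_basis_aut_basis[OF a] that] that \<phi>]
    unfolding inner_aut_basis_fourier_coeff[OF a \<phi>] \<psi>_def .
  have B: "C_symmetric (conj_rot_at lam a) (toeplitz \<phi>) \<longleftrightarrow> coeff_symmetric lam ?c"
    if "cmod lam = 1" for lam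
    unfolding conj_rot_at_def A[OF powers[OF that]] by (rule coeff_symmetric_powers_iff[OF that])
  have C: "C_symmetric (conj_rot lam) (toeplitz \<psi>) \<longleftrightarrow> coeff_symmetric lam ?c"
    if "cmod lam = 1" for lam
    using C_symmetric_toeplitz_iff[OF H2_basis_monomials diagonal_conj_rot[OF that] powers[OF that] \<psi>]
    unfolding inner_monomial_fourier_coeff coeff_symmetric_powers_iff[OF that] .
  have D: "(\<exists>f\<in>H2. AE z in circle. \<phi> z = (f \<circ> disk_aut a) z + cnj ((conj_rot lam f \<circ> disk_aut a) z)) \<longleftrightarrow>
      coeff_symmetric lam ?c" if "cmod lam = 1" for lam
  proof -
    have "(AE z in circle. \<phi> z = (f \<circ> disk_aut a) z + cnj ((conj_rot lam f \<circ> disk_aut a) z)) \<longleftrightarrow>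
        (AE z in circle. \<psi> z = f z + f (lam * cnj z))" for f
    proof -
      have "(AE z in circle. \<phi> z = (f \<circ> disk_aut a) z + cnj ((conj_rot lam f \<circ> disk_aut a) z)) \<longleftrightarrow>
          (AE z in circle. \<psi> (disk_aut a z) = f (disk_aut a z) + f (lam * cnj (disk_aut a z)))"
        by (rule AE_cong) (simp add: \<psi>_def conj_rot_def disk_aut_disk_aut[OF a])
      then show ?thesis
        using disk_aut_AE_iff[OF a, of "\<lambda>z. \<psi> z = f z + f (lam * cnj z)"] by simp
    qed
    then show ?thesis
      using analytic_decomposition_iff[OF Linf_L2[OF \<psi>] that] by simp
  qed
  have E: "(AE z in circle. \<psi> (lam * z) = \<psi> (cnj z)) \<longleftrightarrow> coeff_symmetric lam ?c"
    if "cmod lam = 1" for lam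
    by (rule reflection_symmetric_iff[OF Linf_L2[OF \<psi>] that])

  let ?P = "\<exists>lam\<in>sphere 0 1. coeff_symmetric lam ?c"
  have a_iff: "(\<exists>\<alpha>\<in>unimodular_seqs. C_symmetric (conj_seq \<alpha> a) (toeplitz \<phi>)) \<longleftrightarrow> ?P"
  proof
    assume "\<exists>\<alpha>\<in>unimodular_seqs. C_symmetric (conj_seq \<alpha> a) (toeplitz \<phi>)"
    then obtain \<alpha> where \<alpha>: "\<alpha> \<in> unimodular_seqs" "C_symmetric (conj_seq \<alpha> a) (toeplitz \<phi>)"
      by blast
    from \<alpha>(2)[unfolded A[OF \<alpha>(1)], rule_format]
    have "\<exists>lam. cmod lam = 1 \<and> coeff_symmetric lam ?c"
      by (rule diagonal_unitary_to_character[OF \<alpha>(1)])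
    then show ?P by auto
  next
    assume ?P
    then obtain lam where lam: "cmod lam = 1" "coeff_symmetric lam ?c" by auto
    then have "C_symmetric (conj_seq (\<lambda>m. cnj lam ^ m) a) (toeplitz \<phi>)"
      using B by (simp add: conj_rot_at_def)
    then show "\<exists>\<alpha>\<in>unimodular_seqs. C_symmetric (conj_seq \<alpha> a) (toeplitz \<phi>)"
      using powers[OF lam(1)] by blast
  qed
  have b_iff: "(\<exists>lam\<in>sphere 0 1. C_symmetric (conj_rot_at lam a) (toeplitz \<phi>)) \<longleftrightarrow> ?P"
    by (rule bex_cong) (simp_all add: B)
  have c_iff: "(\<exists>lam\<in>sphere 0 1. C_symmetric (conj_rot lam) (toeplitz \<psi>)) \<longleftrightarrow> ?P"
    by (rule bex_cong) (simp_all add: C)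
  have d_iff: "(\<exists>lam\<in>sphere 0 1. \<exists>f\<in>H2. AE z in circle.
         \<phi> z = (f \<circ> disk_aut a) z + cnj ((conj_rot lam f \<circ> disk_aut a) z)) \<longleftrightarrow> ?P"
    by (rule bex_cong) (use D in auto)
  have e_iff: "(\<exists>lam\<in>sphere 0 1. AE z in circle. \<psi> (lam * z) = \<psi> (cnj z)) \<longleftrightarrow> ?P"
    by (rule bex_cong) (simp_all add: E)
  show ?thesis
    unfolding \<psi>_def[symmetric] a_iff b_iff c_iff d_iff e_iff by simp
qed

end
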